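(* For both modes $\textsc{FAInc}$ and $\textsc{Striped}$, the Counter-based Causal Monitor algorithm produces linearizable executions of the Causal Monitor; that is, in each mode it is a linearizable implementation with respect to the sequential specification of the Causal Monitor.
   Context: **Model.** $N$ asynchronous processes $p_1,\dots,p_N$, each executing its operations sequentially, communicate through atomic shared memory. $e\prec f$ means event $e$ occurs before event $f$ in real time; no two events are simultaneous. A history $H$ is a finite sequence of invocation and response events; it is well-formed if every response is preceded by its matching invocation; an operation is pending if it has been invoked but has not responded. $\mathit{op}_1<_H\mathit{op}_2$ iff $\mathrm{res}(\mathit{op}_1)\prec\mathrm{inv}(\mathit{op}_2)$. **Linearizability.** An implementation is linearizable with respect to a sequential specification (a prefix-closed set of sequential histories, called legal) if for every well-formed history $H$ it produces there is a legal sequential history $S$ such that (L1) $S$ is equivalent to some completion of $H$ (pending operations may be dropped or completed), and (L2) $\mathit{op}_1<_H\mathit{op}_2$ implies $\mathit{op}_1<_S\mathit{op}_2$. **Causal Monitor (sequential specification).** Let $\mathcal I$ be a universe of operation identifiers. The abstract state is a sequence $\mathcal S\in(\{I,R\}\times\mathcal I)^*$, initially empty; $\mathrm{idx}(e,\mathcal S)$ is the position of $e$ in $\mathcal S$, or $\infty$ if absent. - $\mathrm{Add\_Inv}(\mathit{id})$ requires $(I,\mathit{id})\notin\mathcal S$ and appends $(I,\mathit{id})$. - $\mathrm{Add\_Res}(\mathit{id})$ requires $(I,\mathit{id})\in\mathcal S$ and $(R,\mathit{id})\notin\mathcal S$, and appends $(R,\mathit{id})$. - $\mathrm{Precedes}(\mathit{id}_A,\mathit{id}_B)$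 requires $(R,\mathit{id}_A),(R,\mathit{id}_B)\in\mathcal S$, leaves the state unchanged, and returns $\mathtt{true}$ iff $\mathrm{idx}((R,\mathit{id}_A),\mathcal S)<\mathrm{idx}((I,\mathit{id}_B),\mathcal S)$. - $\mathrm{Concurrent}(\mathit{id}_A,\mathit{id}_B)$ has the same requirement, leaves the state unchanged, and returns $\mathtt{true}$ iff $\neg\mathrm{Precedes}(\mathit{id}_A,\mathit{id}_B)\wedge\neg\mathrm{Precedes}(\mathit{id}_B,\mathit{id}_A)$. Requirements are obligations of the callers: each identifier is used by one process, which calls $\mathrm{Add\_Inv}(\mathit{id})$ at most once and then, after it has returned, $\mathrm{Add\_Res}(\mathit{id})$ at most once; queries are called only when both response records have been written. **Counter-based algorithm.** Shared: single-writer multi-reader append-only registers $\mathrm{Reg}[1..N]$ ($\mathrm{Reg}[i]$ written only by $p_i$), initially empty, and a counter $C$ initially $0$. Procedure $\mathrm{Stamp}()$: - mode $\textsc{FAInc}$: atomically fetch-and-increment $C$ and return the fetched value; - mode $\textsc{Striped}$: $C$ is an array of atomic cells $C[1..N]$, initially $0$; process $p_i$ first atomically increments $C[i]$ by one, and afterwards reads all cells one at a time (non-atomically) and returns the sum of the values read. $\mathrm{Add\_Inv}(\mathit{id})$ by $p_i$: $t\gets\mathrm{Stamp}()$, then append $(I,\mathit{id},t)$ to $\mathrm{Reg}[i]$ in one write. $\mathrm{Add\_Res}(\mathit{id})$ by $p_i$: $t\gets\mathrm{Stamp}()$, then append $(R,\mathit{id},t)$ to $\mathrm{Reg}[i]$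 in one write. $\mathrm{Precedes}(\mathit{id}_A,\mathit{id}_B)$: let $t_A$ be the timestamp stored with $(R,\mathit{id}_A)$ and $t_B$ the timestamp stored with $(I,\mathit{id}_B)$; return $t_A<t_B$. $\mathrm{Concurrent}$ is computed from the two $\mathrm{Precedes}$ values. *)

theory Defs
  imports Main "HOL-Library.Extended_Nat"
begin

section \<open>Histories and linearizability\<close>

datatype ('p, 'op, 'ret) event =
    Inv (proc: 'p) 'op
  | Res (proc: 'p) 'ret

type_synonym ('p, 'op, 'ret) history = "('p, 'op, 'ret) event list"

definition n_inv :: "'p \<Rightarrow> ('p, 'op, 'ret) history \<Rightarrow> nat" where
  "n_inv p H = length (filter (\<lambda>e. \<exists>x. e = Inv p x) H)"

definition n_res :: "'p \<Rightarrow> ('p, 'op, 'ret) history \<Rightarrow> nat" where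
  "n_res p H = length (filter (\<lambda>e. \<exists>r. e = Res p r) H)"

text \<open>Processes are sequential, so an operation of a history is identified by a pair \<open>(p, n)\<close>:
  the operation whose invocation is the invocation number \<open>n\<close> (from 0) of process \<open>p\<close>. Its matching
  response is the response number \<open>n\<close> of \<open>p\<close>.\<close>

definition inv_at :: "('p, 'op, 'ret) history \<Rightarrow> 'p \<times> nat \<Rightarrow> nat \<Rightarrow> bool" where
  "inv_at H a i \<longleftrightarrow>
     i < length H \<and> (\<exists>x. H ! i = Inv (fst a) x) \<and> n_inv (fst a) (take i H) = snd a"

definition res_at :: "('p, 'op, 'ret) history \<Rightarrow> 'p \<times> nat \<Rightarrow> nat \<Rightarrow> bool" where
  "res_at H a i \<longleftrightarrow>
     i < length H \<and> (\<exists>r. H ! i = Res (fst a) r) \<and> n_res (fst a) (take i H) = snd a"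

definition operations :: "('p, 'op, 'ret) history \<Rightarrow> ('p \<times> nat) set" where
  "operations H = {a. \<exists>i. inv_at H a i}"

definition pending :: "('p, 'op, 'ret) history \<Rightarrow> 'p \<times> nat \<Rightarrow> bool" where
  "pending H a \<longleftrightarrow> a \<in> operations H \<and> (\<nexists>i. res_at H a i)"

definition op_less :: "('p, 'op, 'ret) history \<Rightarrow> 'p \<times> nat \<Rightarrow> 'p \<times> nat \<Rightarrow> bool" where
  "op_less H a b \<longleftrightarrow> (\<exists>i j. res_at H a i \<and> inv_at H b j \<and> i < j)"

text \<open>The first inequality says that every response is preceded by its matching invocation, the
  second one that a process has at most one outstanding operation at any time.\<close>

definition well_formed :: "('p, 'op, 'ret) history \<Rightarrow> bool" where
  "well_formed H \<longleftrightarrow> (\<forall>k p. n_res p (take k H) \<le> n_inv p (take k H) \<and>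
                             n_inv p (take k H) \<le> Suc (n_res p (take k H)))"

text \<open>A completion drops some pending invocations (the positions in \<open>D\<close>) and appends responses
  \<open>Rs\<close> for all the other ones.\<close>

definition completion :: "('p, 'op, 'ret) history \<Rightarrow> ('p, 'op, 'ret) history \<Rightarrow> bool" where
  "completion H H' \<longleftrightarrow>
     (\<exists>D Rs. (\<forall>i\<in>D. \<exists>a. inv_at H a i \<and> pending H a) \<and>
             (\<forall>e\<in>set Rs. \<exists>p r. e = Res p r) \<and>
             H' = nths H (- D) @ Rs \<and>
             well_formed H' \<and> (\<nexists>a. pending H' a))"

definition equivalent :: "('p, 'op, 'ret) history \<Rightarrow> ('p, 'op, 'ret) history \<Rightarrow> bool" where
  "equivalent H H' \<longleftrightarrow> (\<forall>p. filter (\<lambda>e. proc e = p) H = filter (\<lambda>e. proc e = p) H')"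

text \<open>Complete sequential histories are represented by the list of their operations, each given with
  its process and its return value; \<open>events_of\<close> is the underlying history.\<close>

type_synonym ('p, 'op, 'ret) seq_history = "('p \<times> 'op \<times> 'ret) list"

definition events_of :: "('p, 'op, 'ret) seq_history \<Rightarrow> ('p, 'op, 'ret) history" where
  "events_of xs = concat (map (\<lambda>(p, x, r). [Inv p x, Res p r]) xs)"

text \<open>The order condition ranges over the operations that occur in the linearization, since dropped
  pending operations have no place in it.\<close>

definition linearizable ::
    "('p, 'op, 'ret) history set \<Rightarrow> ('p, 'op, 'ret) seq_history set \<Rightarrow> bool" where
  "linearizable Hs legal \<longleftrightarrow>
     (\<forall>H\<in>Hs. well_formed H \<longrightarrow>
        (\<exists>xs\<in>legal.
           (\<exists>H'. completion H H' \<and> equivalent (events_of xs) H') \<and>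
           (\<forall>a\<in>operations (events_of xs). \<forall>b\<in>operations (events_of xs).
              op_less H a b \<longrightarrow> op_less (events_of xs) a b)))"


section \<open>Sequential specification of the causal monitor\<close>

datatype mark = IMark | RMark

datatype 'id cm_op = Add_Inv 'id | Add_Res 'id | Precedes 'id 'id | Concurrent 'id 'id

datatype cm_ret = Ack | Truth bool

type_synonym 'id cm_state = "(mark \<times> 'id) list"

definition idx :: "'a \<Rightarrow> 'a list \<Rightarrow> enat" where
  "idx e S = (if e \<in> set S then enat (LEAST n. n < length S \<and> S ! n = e) else \<infinity>)"

definition cm_precedes :: "'id cm_state \<Rightarrow> 'id \<Rightarrow> 'id \<Rightarrow> bool" where
  "cm_precedes S a b \<longleftrightarrow> idx (RMark, a) S < idx (IMark, b) S"

fun cm_requires :: "'id cm_state \<Rightarrow> 'id cm_op \<Rightarrow> bool" where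
  "cm_requires S (Add_Inv a) \<longleftrightarrow> (IMark, a) \<notin> set S"
| "cm_requires S (Add_Res a) \<longleftrightarrow> (IMark, a) \<in> set S \<and> (RMark, a) \<notin> set S"
| "cm_requires S (Precedes a b) \<longleftrightarrow> (RMark, a) \<in> set S \<and> (RMark, b) \<in> set S"
| "cm_requires S (Concurrent a b) \<longleftrightarrow> (RMark, a) \<in> set S \<and> (RMark, b) \<in> set S"

fun cm_next :: "'id cm_state \<Rightarrow> 'id cm_op \<Rightarrow> 'id cm_state" where
  "cm_next S (Add_Inv a) = S @ [(IMark, a)]"
| "cm_next S (Add_Res a) = S @ [(RMark, a)]"
| "cm_next S (Precedes a b) = S"
| "cm_next S (Concurrent a b) = S"

fun cm_return :: "'id cm_state \<Rightarrow> 'id cm_op \<Rightarrow> cm_ret" where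
  "cm_return S (Add_Inv a) = Ack"
| "cm_return S (Add_Res a) = Ack"
| "cm_return S (Precedes a b) = Truth (cm_precedes S a b)"
| "cm_return S (Concurrent a b) = Truth (\<not> cm_precedes S a b \<and> \<not> cm_precedes S b a)"

fun cm_legal :: "'id cm_state \<Rightarrow> ('p, 'id cm_op, cm_ret) seq_history \<Rightarrow> bool" where
  "cm_legal S [] \<longleftrightarrow> True"
| "cm_legal S ((p, x, r) # xs) \<longleftrightarrow>
     cm_requires S x \<and> r = cm_return S x \<and> cm_legal (cm_next S x) xs"

definition causal_monitor :: "('p, 'id cm_op, cm_ret) seq_history set" where
  "causal_monitor = {xs. cm_legal [] xs}"

lemma causal_monitor_prefix_closed: "xs @ ys \<in> causal_monitor \<Longrightarrow> xs \<in> causal_monitor"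
proof -
  have "cm_legal S (xs @ ys) \<Longrightarrow> cm_legal S xs" for S
    by (induction S xs rule: cm_legal.induct) auto
  then show "xs @ ys \<in> causal_monitor \<Longrightarrow> xs \<in> causal_monitor"
    by (auto simp: causal_monitor_def)
qed


section \<open>The counter-based algorithm\<close>

datatype stamp_mode = FAInc | Striped

text \<open>Control state of a process:
  \<^item> \<open>Stamping k a\<close>: in an add operation for the record \<open>(k, a)\<close>, before its first access to the counter;
  \<^item> \<open>Summing k a U s\<close>: the own cell has been incremented, the cells in \<open>U\<close> are still to be read, and
    \<open>s\<close> is the sum of the values read so far (only in mode \<open>Striped\<close>);
  \<^item> \<open>Writing k a t\<close>: \<open>Stamp\<close> has returned \<open>t\<close>, and the record is not yet written;
  \<^item> \<open>Looking x ks U ts\<close>: in the query \<open>x\<close>, with the timestamps of the records \<open>ks\<close> still to be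
    determined, those in \<open>ts\<close> already found, and the registers in \<open>U\<close> not yet searched for the first
    record of \<open>ks\<close>;
  \<^item> \<open>Done r\<close>: about to respond with \<open>r\<close>.\<close>

datatype 'id control =
    Idle
  | Stamping mark 'id
  | Summing mark 'id "nat set" nat
  | Writing mark 'id nat
  | Looking "'id cm_op" "(mark \<times> 'id) list" "nat set" "nat list"
  | Done cm_ret

record 'id config =
  counter :: nat                                \<comment> \<open>\<open>C\<close> in mode \<open>FAInc\<close>\<close>
  cell :: "nat \<Rightarrow> nat"                           \<comment> \<open>\<open>C[i]\<close> in mode \<open>Striped\<close>\<close>
  reg :: "nat \<Rightarrow> (mark \<times> 'id \<times> nat) list"
  control :: "nat \<Rightarrow> 'id control"

definition init_config :: "'id config" where
  "init_config = \<lparr>counter = 0, cell = (\<lambda>_. 0), reg = (\<lambda>_. []), control = (\<lambda>_. Idle)\<rparr>"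

text \<open>\<open>Precedes a b\<close> needs the timestamps of these two records; \<open>Concurrent a b\<close> evaluates
  \<open>Precedes a b\<close> and then \<open>Precedes b a\<close>.\<close>

definition precedes_keys :: "'id \<Rightarrow> 'id \<Rightarrow> (mark \<times> 'id) list" where
  "precedes_keys a b = [(RMark, a), (IMark, b)]"

fun start :: "nat \<Rightarrow> 'id cm_op \<Rightarrow> 'id control" where
  "start N (Add_Inv a) = Stamping IMark a"
| "start N (Add_Res a) = Stamping RMark a"
| "start N (Precedes a b) = Looking (Precedes a b) (precedes_keys a b) {1..N} []"
| "start N (Concurrent a b) =
     Looking (Concurrent a b) (precedes_keys a b @ precedes_keys b a) {1..N} []"

fun answer :: "'id cm_op \<Rightarrow> nat list \<Rightarrow> cm_ret" where
  "answer (Precedes a b) ts = Truth (ts ! 0 < ts ! 1)"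
| "answer (Concurrent a b) ts = Truth (\<not> ts ! 0 < ts ! 1 \<and> \<not> ts ! 2 < ts ! 3)"
| "answer _ ts = Ack"

definition goto :: "nat \<Rightarrow> 'id control \<Rightarrow> 'id config \<Rightarrow> 'id config" where
  "goto p l c = c\<lparr>control := (control c)(p := l)\<rparr>"

text \<open>One atomic step of process \<open>p\<close> inside an operation; each step accesses at most one shared
  object. Cells and registers are scanned in an arbitrary order.\<close>

inductive step :: "stamp_mode \<Rightarrow> nat \<Rightarrow> nat \<Rightarrow> 'id config \<Rightarrow> 'id config \<Rightarrow> bool"
  for m :: stamp_mode and N p :: nat and c :: "'id config" where
  fetch_inc:
    "\<lbrakk>m = FAInc; control c p = Stamping k a\<rbrakk> \<Longrightarrow>
     step m N p c (goto p (Writing k a (counter c)) (c\<lparr>counter := counter c + 1\<rparr>))"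
| incr_cell:
    "\<lbrakk>m = Striped; control c p = Stamping k a\<rbrakk> \<Longrightarrow>
     step m N p c (goto p (Summing k a {1..N} 0) (c\<lparr>cell := (cell c)(p := cell c p + 1)\<rparr>))"
| read_cell:
    "\<lbrakk>control c p = Summing k a U s; q \<in> U\<rbrakk> \<Longrightarrow>
     step m N p c (goto p (Summing k a (U - {q}) (s + cell c q)) c)"
| sum_done:
    "control c p = Summing k a {} s \<Longrightarrow> step m N p c (goto p (Writing k a s) c)"
| write_record:
    "control c p = Writing k a t \<Longrightarrow>
     step m N p c (goto p (Done Ack) (c\<lparr>reg := (reg c)(p := reg c p @ [(k, a, t)])\<rparr>))"
| lookup_hit:
    "\<lbrakk>control c p = Looking x ((k, a) # ks) U ts; q \<in> U; (k, a, t) \<in> set (reg c q)\<rbrakk> \<Longrightarrow>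
     step m N p c (goto p (Looking x ks {1..N} (ts @ [t])) c)"
| lookup_miss:
    "\<lbrakk>control c p = Looking x ((k, a) # ks) U ts; q \<in> U; \<nexists>t. (k, a, t) \<in> set (reg c q)\<rbrakk> \<Longrightarrow>
     step m N p c (goto p (Looking x ((k, a) # ks) (U - {q}) ts) c)"
| lookup_done:
    "control c p = Looking x [] U ts \<Longrightarrow> step m N p c (goto p (Done (answer x ts)) c)"

definition written :: "'id config \<Rightarrow> mark \<Rightarrow> 'id \<Rightarrow> bool" where
  "written c k a \<longleftrightarrow> (\<exists>q t. (k, a, t) \<in> set (reg c q))"

text \<open>Obligations of the callers, at the invocation of an operation by \<open>p\<close> after history \<open>H\<close> in
  configuration \<open>c\<close>. Only an idle process invokes operations (see below), so an earlier
  \<open>Add_Inv a\<close> of the same process has returned.\<close>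

fun may_call ::
    "(nat, 'id cm_op, cm_ret) history \<Rightarrow> 'id config \<Rightarrow> nat \<Rightarrow> 'id cm_op \<Rightarrow> bool" where
  "may_call H c p (Add_Inv a) \<longleftrightarrow> (\<forall>q. Inv q (Add_Inv a) \<notin> set H)"
| "may_call H c p (Add_Res a) \<longleftrightarrow>
     Inv p (Add_Inv a) \<in> set H \<and> (\<forall>q. Inv q (Add_Res a) \<notin> set H)"
| "may_call H c p (Precedes a b) \<longleftrightarrow> written c RMark a \<and> written c RMark b"
| "may_call H c p (Concurrent a b) \<longleftrightarrow> written c RMark a \<and> written c RMark b"

text \<open>\<open>execution m N H c\<close>: some interleaved execution of processes \<open>1, \<dots>, N\<close> produces the history
  \<open>H\<close> and ends in configuration \<open>c\<close>.\<close>

inductive execution ::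
    "stamp_mode \<Rightarrow> nat \<Rightarrow> (nat, 'id cm_op, cm_ret) history \<Rightarrow> 'id config \<Rightarrow> bool"
  for m :: stamp_mode and N :: nat where
  init: "execution m N [] init_config"
| invoke:
    "\<lbrakk>execution m N H c; p \<in> {1..N}; control c p = Idle; may_call H c p x\<rbrakk> \<Longrightarrow>
     execution m N (H @ [Inv p x]) (goto p (start N x) c)"
| internal:
    "\<lbrakk>execution m N H c; p \<in> {1..N}; step m N p c c'\<rbrakk> \<Longrightarrow> execution m N H c'"
| respond:
    "\<lbrakk>execution m N H c; p \<in> {1..N}; control c p = Done r\<rbrakk> \<Longrightarrow>
     execution m N (H @ [Res p r]) (goto p Idle c)"

definition monitor_histories ::
    "stamp_mode \<Rightarrow> nat \<Rightarrow> (nat, 'id cm_op, cm_ret) history set" where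
  "monitor_histories m N = {H. \<exists>c. execution m N H c}"

text \<open>The well-formedness premise of linearizability excludes no history of the algorithm.\<close>

lemma execution_counts:
  "execution m N H c \<Longrightarrow>
   n_inv p H = n_res p H + (if control c p = Idle then 0 else 1)"
proof (induction rule: execution.induct)
  case init
  show ?case by (simp add: n_inv_def n_res_def init_config_def)
next
  case (invoke H c q x)
  then show ?case by (cases x) (auto simp: n_inv_def n_res_def goto_def)
next
  case (internal H c q c')
  from internal.hyps(3) have "control c' p = Idle \<longleftrightarrow> control c p = Idle"
    by (cases rule: step.cases) (auto simp: goto_def)
  then show ?case using internal.IH by simp
next
  case (respond H c q r)
  then show ?case by (auto simp: n_inv_def n_res_def goto_def)
qed

lemma monitor_histories_well_formed:
  assumes "H \<in> monitor_histories m N"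
  shows "well_formed H"
proof -
  obtain c where "execution m N H c"
    using assms by (auto simp: monitor_histories_def)
  then have "n_res p (take k H) \<le> n_inv p (take k H) \<and>
             n_inv p (take k H) \<le> Suc (n_res p (take k H))" for k p
  proof (induction arbitrary: k rule: execution.induct)
    case init
    show ?case by (simp add: n_inv_def n_res_def)
  next
    case (invoke H c q x)
    have "execution m N (H @ [Inv q x]) (goto q (start N x) c)"
      using invoke.hyps by (rule execution.invoke)
    from execution_counts[OF this, of p] invoke.IH[of k] show ?case
      by (cases "k \<le> length H") (auto split: if_splits)
  next
    case (internal H c q c')
    then show ?case by blast
  next
    case (respond H c q r)
    have "execution m N (H @ [Res q r]) (goto q Idle c)"
      using respond.hyps by (rule execution.respond)
    from execution_counts[OF this, of p] respond.IH[of k] show ?case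
      by (cases "k \<le> length H") (auto split: if_splits)
  qed
  then show ?thesis by (simp add: well_formed_def)
qed

end

theory Submission
  imports Defs "HOL-Library.Product_Lexorder"
begin

text \<open>Let \<open>V\<close> be the value of the counter, in mode \<open>Striped\<close> the sum of all cells. Stamps are normalized
  by adding one in mode \<open>FAInc\<close>; then the stamp of an add operation lies between the value of \<open>V\<close> just
  after its own increment and the value of \<open>V\<close> when \<open>Stamp\<close> returns. Hence an add operation that
  starts after another one has returned gets a strictly larger stamp. A query is assigned the value
  of \<open>V\<close> at its invocation. The linearization sorts by these times, at equal times invocation records
  come before response records and these before queries, and remaining ties are broken by the order of
  invocation. Of the pending operations it contains those that are about to respond: an add operation
  whose record is written may already have been seen by a query, all others can be dropped. A query may
  be placed this late because appending records does not change the answer about those present.\<close>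

section \<open>Histories\<close>

text \<open>The elements satisfying \<open>P\<close> are numbered from 0 by how many precede them.
  This turns the positional notions \<open>inv_at\<close> and \<open>res_at\<close> into comparisons
  of counts, which are easy to follow when events are appended.\<close>

lemma ex_nth_filter_iff:
  "(\<exists>i < length xs. P (xs ! i) \<and> length (filter P (take i xs)) = n) \<longleftrightarrow> n < length (filter P xs)"
proof (induction xs rule: rev_induct)
  case (snoc x xs)
  let ?Q = "\<lambda>xs i. P (xs ! i) \<and> length (filter P (take i xs)) = n"
  have "(\<exists>i < length (xs @ [x]). ?Q (xs @ [x]) i) \<longleftrightarrow>
        ?Q (xs @ [x]) (length xs) \<or> (\<exists>i < length xs. ?Q (xs @ [x]) i)"
    by (simp only: length_append_singleton Ex_less_Suc)
  also have "(\<exists>i < length xs. ?Q (xs @ [x]) i) \<longleftrightarrow> (\<exists>i < length xs. ?Q xs i)"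
    by (simp add: nth_append cong: conj_cong)
  also have "\<dots> \<longleftrightarrow> n < length (filter P xs)" by (rule snoc.IH)
  finally show ?case by (cases "P x") (simp_all add: less_Suc_eq disj_commute eq_commute)
qed simp

lemma ex_inv_at_iff: "(\<exists>i. inv_at H a i) \<longleftrightarrow> snd a < n_inv (fst a) H"
  using ex_nth_filter_iff[of H "\<lambda>e. \<exists>x. e = Inv (fst a) x" "snd a"]
  by (auto simp: inv_at_def n_inv_def)

lemma ex_res_at_iff: "(\<exists>i. res_at H a i) \<longleftrightarrow> snd a < n_res (fst a) H"
  using ex_nth_filter_iff[of H "\<lambda>e. \<exists>x. e = Res (fst a) x" "snd a"]
  by (auto simp: res_at_def n_res_def)

lemma operations_iff: "a \<in> operations H \<longleftrightarrow> snd a < n_inv (fst a) H"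
  by (simp add: operations_def ex_inv_at_iff)

lemma pending_iff: "pending H a \<longleftrightarrow> n_res (fst a) H \<le> snd a \<and> snd a < n_inv (fst a) H"
  using ex_res_at_iff[of H a] by (auto simp: pending_def operations_iff)

lemma op_less_completed: "op_less H a b \<Longrightarrow> snd a < n_res (fst a) H"
  using ex_res_at_iff[of H a] by (auto simp: op_less_def)

lemma op_less_invoked: "op_less H a b \<Longrightarrow> snd b < n_inv (fst b) H"
  using ex_inv_at_iff[of H b] by (auto simp: op_less_def)

lemma n_inv_simps [simp]:
  "n_inv p [] = 0"
  "n_inv p (H @ H') = n_inv p H + n_inv p H'"
  "n_inv p (Inv q x # H) = (if p = q then 1 else 0) + n_inv p H"
  "n_inv p (Res q r # H) = n_inv p H"
  by (auto simp: n_inv_def)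

lemma n_res_simps [simp]:
  "n_res p [] = 0"
  "n_res p (H @ H') = n_res p H + n_res p H'"
  "n_res p (Inv q x # H) = n_res p H"
  "n_res p (Res q r # H) = (if p = q then 1 else 0) + n_res p H"
  by (auto simp: n_res_def)

text \<open>All responses so far stand before the new invocation, so the only new pairs lead from a
  completed operation to the new one.\<close>

lemma op_less_snoc_Inv:
  "op_less (H @ [Inv p x]) a b \<longleftrightarrow>
     op_less H a b \<or> b = (p, n_inv p H) \<and> snd a < n_res (fst a) H"
proof -
  have res: "res_at (H @ [Inv p x]) a i \<longleftrightarrow> res_at H a i" for i
    by (auto simp: res_at_def nth_append)
  have inv: "inv_at (H @ [Inv p x]) b j \<longleftrightarrow>
      inv_at H b j \<or> (j = length H \<and> b = (p, n_inv p H))" for j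
    by (cases b) (auto simp: inv_at_def nth_append)
  have lt: "res_at H a i \<Longrightarrow> i < length H" for i
    by (simp add: res_at_def)
  show ?thesis
    unfolding op_less_def res inv ex_res_at_iff[symmetric] using lt by blast
qed

text \<open>A response at the end stands before no invocation.\<close>

lemma op_less_snoc_Res: "op_less (H @ [Res p r]) a b \<longleftrightarrow> op_less H a b"
proof -
  have res: "res_at (H @ [Res p r]) a i \<longleftrightarrow>
      res_at H a i \<or> (i = length H \<and> a = (p, n_res p H))" for i
    by (cases a) (auto simp: res_at_def nth_append)
  have inv: "inv_at (H @ [Res p r]) b j \<longleftrightarrow> inv_at H b j" for j
    by (auto simp: inv_at_def nth_append)
  have lt: "inv_at H b j \<Longrightarrow> j < length H" for j
    by (simp add: inv_at_def)
  show ?thesis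
    unfolding op_less_def res inv using lt by (metis order_less_asym)
qed

lemma op_less_same_process:
  assumes "well_formed H" "i < j" "j < n_inv p H"
  shows "op_less H (p, i) (p, j)"
proof -
  obtain k where k: "inv_at H (p, j) k"
    using assms(3) ex_inv_at_iff[of H "(p, j)"] by auto
  then obtain x where x: "k < length H" "H ! k = Inv p x" "n_inv p (take k H) = j"
    by (auto simp: inv_at_def)
  then have "take (Suc k) H = take k H @ [Inv p x]"
    by (simp add: take_Suc_conv_app_nth)
  \<comment> \<open>This prefix contains \<open>j + 1\<close> invocations of \<open>p\<close>, and
    at most one of them is outstanding.\<close>
  then have "j \<le> n_res p (take k H)"
    using assms(1)[unfolded well_formed_def, rule_format, of p "Suc k"] x(3) by simp
  then obtain i' where "res_at (take k H) (p, i) i'"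
    using assms(2) ex_res_at_iff[of "take k H" "(p, i)"] by auto
  then have "res_at H (p, i) i'" "i' < k"
    by (auto simp: res_at_def min_absorb1)
  then show ?thesis using k by (auto simp: op_less_def)
qed

section \<open>Projections to one process and deletion of events\<close>

lemma n_inv_projection: "n_inv p (filter (\<lambda>e. proc e = p) H) = n_inv p H"
proof -
  have "filter (\<lambda>e. \<exists>x. e = Inv p x) (filter (\<lambda>e. proc e = p) H) =
      filter (\<lambda>e. \<exists>x. e = Inv p x) H"
    by (induction H) auto
  then show ?thesis by (simp only: n_inv_def)
qed

lemma n_res_projection: "n_res p (filter (\<lambda>e. proc e = p) H) = n_res p H"
proof -
  have "filter (\<lambda>e. \<exists>r. e = Res p r) (filter (\<lambda>e. proc e = p) H) =
      filter (\<lambda>e. \<exists>r. e = Res p r) H"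
    by (induction H) auto
  then show ?thesis by (simp only: n_res_def)
qed

lemma filter_take: "\<exists>j. filter P (take k xs) = take j (filter P xs)"
proof
  show "filter P (take k xs) = take (length (filter P (take k xs))) (filter P xs)"
    using filter_append[of P "take k xs" "drop k xs"] by (simp del: filter_append)
qed

lemma filter_nths_superset:
  "(\<And>i. i < length xs \<Longrightarrow> P (xs ! i) \<Longrightarrow> i \<in> A) \<Longrightarrow> filter P (nths xs A) = filter P xs"
proof (induction xs rule: rev_induct)
  case (snoc x xs)
  have "filter P (nths xs A) = filter P xs"
  proof (rule snoc.IH)
    show "i \<in> A" if "i < length xs" "P (xs ! i)" for i
      using snoc.prems[of i] that by (simp add: nth_append)
  qed
  moreover have "P x \<Longrightarrow> length xs \<in> A"
    using snoc.prems[of "length xs"] by simp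
  ultimately show ?case by (auto simp: nths_append)
qed simp

text \<open>Serves to delete the pending invocation of one process, with \<open>P\<close> selecting
  the events of that process. On the elements outside \<open>P\<close> the set \<open>A\<close> is
  arbitrary.\<close>

lemma filter_nths_drop_last:
  assumes "filter P xs = ys @ [y]"
    and "\<And>i. i < length xs \<Longrightarrow> P (xs ! i) \<Longrightarrow> i \<in> A \<longleftrightarrow> length (filter P (take i xs)) < length ys"
  shows "filter P (nths xs A) = ys"
proof -
  \<comment> \<open>Reversal turns the last element satisfying \<open>P\<close> into the first one,
    at which the list can be split.\<close>
  have "filter P (rev xs) = y # rev ys"
    using assms(1) by (simp flip: rev_filter)
  then obtain vs us where "rev xs = vs @ y # us" "\<forall>v\<in>set vs. \<not> P v" "P y" "rev ys = filter P us"
    by (auto simp: filter_eq_Cons_iff)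
  then obtain us vs where xs: "xs = us @ y # vs" and us: "filter P us = ys" and vs: "filter P vs = []"
    and y: "P y"
    using that[of "rev us" "rev vs"]
    by (auto simp: rev_filter[symmetric] filter_empty_conv rev_swap)
  have "length us \<notin> A"
    using assms(2)[of "length us"] us y by (simp add: xs)
  moreover have "filter P (nths us A) = filter P us"
  proof (rule filter_nths_superset)
    fix i assume i: "i < length us" "P (us ! i)"
    have "filter P us = filter P (take i us) @ us ! i # filter P (drop (Suc i) us)"
      using id_take_nth_drop[OF i(1)] i(2) by (metis filter.simps(2) filter_append)
    then have "length (filter P (take i us)) < length ys"
      using us by simp
    then show "i \<in> A"
      using assms(2)[of i] i by (simp add: xs nth_append)
  qed
  moreover have "filter P (nths vs B) = []" for B
    using vs set_nths_subset[of vs B] by (fastforce simp: filter_empty_conv)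
  ultimately show ?thesis
    by (simp add: xs us nths_append nths_Cons)
qed

section \<open>Histories given by lists of operations\<close>

lemma events_of_append: "events_of (xs @ ys) = events_of xs @ events_of ys"
  by (simp add: events_of_def)

lemma events_of_Nil [simp]: "events_of [] = []"
  by (simp add: events_of_def)

lemma events_of_Cons [simp]: "events_of ((p, x, r) # ys) = Inv p x # Res p r # events_of ys"
  by (simp add: events_of_def)

lemma n_inv_events_of: "n_inv p (events_of xs) = length (filter (\<lambda>y. fst y = p) xs)"
  by (induction xs) auto

lemma n_res_events_of: "n_res p (events_of xs) = length (filter (\<lambda>y. fst y = p) xs)"
  by (induction xs) auto

lemma events_of_projection:
  "filter (\<lambda>e. proc e = p) (events_of xs) = events_of (filter (\<lambda>y. fst y = p) xs)"
  by (induction xs) auto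

lemma well_formed_snoc:
  assumes "well_formed H"
    "\<And>p. n_res p (H @ [e]) \<le> n_inv p (H @ [e]) \<and> n_inv p (H @ [e]) \<le> Suc (n_res p (H @ [e]))"
  shows "well_formed (H @ [e])"
  unfolding well_formed_def
proof (intro allI)
  fix k p
  show "n_res p (take k (H @ [e])) \<le> n_inv p (take k (H @ [e])) \<and>
        n_inv p (take k (H @ [e])) \<le> Suc (n_res p (take k (H @ [e])))"
    using assms(1) assms(2)[of p] by (cases "k \<le> length H") (simp_all add: well_formed_def)
qed

lemma well_formed_events_of: "well_formed (events_of xs)"
proof (induction xs rule: rev_induct)
  case Nil
  show ?case by (simp add: well_formed_def)
next
  case (snoc y xs)
  obtain p x r where y: "y = (p, x, r)" by (cases y)
  have "well_formed (events_of xs @ [Inv p x])"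
    by (rule well_formed_snoc[OF snoc]) (simp add: n_inv_events_of n_res_events_of)
  then have "well_formed ((events_of xs @ [Inv p x]) @ [Res p r])"
    by (rule well_formed_snoc) (simp add: n_inv_events_of n_res_events_of)
  then show ?case by (simp add: y events_of_append)
qed

text \<open>Both properties can be read off the projections to single processes, and the projection
  of a prefix is a prefix of the projection. Hence a candidate completion only has to be shown
  equivalent to the linearization.\<close>

lemma equivalent_events_of:
  assumes "equivalent (events_of xs) H"
  shows "well_formed H" and "\<not> pending H a"
proof -
  have proj: "filter (\<lambda>e. proc e = p) H = events_of (filter (\<lambda>y. fst y = p) xs)" for p
    using assms by (simp add: equivalent_def events_of_projection)
  show "well_formed H"
    unfolding well_formed_def
  proof (intro allI)
    fix k p
    obtain j where j: "filter (\<lambda>e. proc e = p) (take k H) =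
        take j (filter (\<lambda>e. proc e = p) H)"
      using filter_take by blast
    show "n_res p (take k H) \<le> n_inv p (take k H) \<and>
          n_inv p (take k H) \<le> Suc (n_res p (take k H))"
      using well_formed_events_of[of "filter (\<lambda>y. fst y = p) xs"]
      by (subst (1 2) n_res_projection[symmetric], subst (1 2) n_inv_projection[symmetric])
        (simp add: j proj well_formed_def)
  qed
  have "n_inv p H = n_res p H" for p
    using n_inv_projection[of p H] n_res_projection[of p H]
    by (simp add: proj n_inv_events_of n_res_events_of)
  then show "\<not> pending H a" by (simp add: pending_iff)
qed

lemma take_events_of: "take (2 * j) (events_of xs) = events_of (take j xs)"
proof (induction xs arbitrary: j)
  case (Cons y xs)
  then show ?case by (cases j; cases y) auto
qed simp

lemma events_of_nth:
  "j < length xs \<Longrightarrow>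
   events_of xs ! (2 * j) = Inv (fst (xs ! j)) (fst (snd (xs ! j))) \<and>
   events_of xs ! Suc (2 * j) = Res (fst (xs ! j)) (snd (snd (xs ! j)))"
proof (induction xs arbitrary: j)
  case (Cons y xs)
  then show ?case by (cases j; cases y) auto
qed simp

lemma length_events_of: "length (events_of xs) = 2 * length xs"
  by (induction xs) auto


text \<open>\<open>L\<close> lists operations by their identifiers in a concurrent history. The
  assumption ensures that the same identifiers denote the same operations in the sequential history
  built from \<open>L\<close>, so the two real-time orders can be compared directly.\<close>

locale numbered =
  fixes L :: "('p \<times> nat) list" and f :: "'p \<times> nat \<Rightarrow> 'op \<times> 'ret" and d :: "'p \<Rightarrow> nat"
  assumes projection: "\<And>p. filter (\<lambda>a. fst a = p) L = map (Pair p) [0..<d p]"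
begin

abbreviation seq_hist :: "('p, 'op, 'ret) seq_history" where
  "seq_hist \<equiv> map (\<lambda>a. (fst a, f a)) L"

text \<open>In the projection to a process \<open>p\<close> the entry at index \<open>n\<close> is
  \<open>(p, n)\<close>, and the index of \<open>L ! j\<close> there is the number of earlier
  entries of its process.\<close>

lemma count_before:
  assumes "j < length L"
  shows "length (filter (\<lambda>a. fst a = fst (L ! j)) (take j L)) = snd (L ! j)"
proof -
  let ?p = "fst (L ! j)"
  let ?n = "length (filter (\<lambda>a. fst a = ?p) (take j L))"
  have L: "L = take j L @ L ! j # drop (Suc j) L"
    using assms by (rule id_take_nth_drop)
  have eq: "map (Pair ?p) [0..<d ?p] =
      filter (\<lambda>a. fst a = ?p) (take j L) @ L ! j # filter (\<lambda>a. fst a = ?p) (drop (Suc j) L)"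
    unfolding projection[symmetric] by (subst L) (simp del: append_take_drop_id)
  then have "?n < length (map (Pair ?p) [0..<d ?p])" by simp
  then have "snd (map (Pair ?p) [0..<d ?p] ! ?n) = ?n" by simp
  then show ?thesis unfolding eq nth_append_length by (rule sym)
qed

lemma inv_at_seq: "j < length L \<Longrightarrow> inv_at (events_of seq_hist) (L ! j) (2 * j)"
  using events_of_nth[of j seq_hist] count_before[of j]
  by (simp add: inv_at_def length_events_of take_events_of take_map n_inv_events_of filter_map o_def)

lemma res_at_seq:
  assumes "j < length L"
  shows "res_at (events_of seq_hist) (L ! j) (Suc (2 * j))"
proof -
  have "Suc (2 * j) < length (events_of seq_hist)"
    using assms by (simp add: length_events_of)
  moreover from this have "take (Suc (2 * j)) (events_of seq_hist) =
      take (2 * j) (events_of seq_hist) @ [Inv (fst (L ! j)) (fst (f (L ! j)))]"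
    using events_of_nth[of j seq_hist] assms by (simp add: take_Suc_conv_app_nth)
  ultimately show ?thesis
    using events_of_nth[of j seq_hist] count_before[of j] assms
    by (simp add: res_at_def take_events_of take_map n_res_events_of filter_map o_def)
qed

lemma op_less_seq:
  "i < j \<Longrightarrow> j < length L \<Longrightarrow> op_less (events_of seq_hist) (L ! i) (L ! j)"
  using inv_at_seq[of j] res_at_seq[of i] unfolding op_less_def
  by (intro exI[of _ "Suc (2 * i)"] exI[of _ "2 * j"]) auto

lemma operations_seq: "operations (events_of seq_hist) = set L"
proof -
  have "a \<in> set L \<longleftrightarrow> snd a < d (fst a)" for a
  proof -
    have "a \<in> set L \<longleftrightarrow> a \<in> set (filter (\<lambda>b. fst b = fst a) L)" by simp
    also have "\<dots> \<longleftrightarrow> snd a < d (fst a)"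
      unfolding projection by (cases a) auto
    finally show ?thesis .
  qed
  moreover have "length (filter (\<lambda>a. fst a = p) L) = d p" for p
    by (simp add: projection)
  ultimately show ?thesis
    by (auto simp: operations_iff n_inv_events_of filter_map o_def)
qed

end

section \<open>The sequential specification\<close>

fun add_op :: "mark \<Rightarrow> 'id \<Rightarrow> 'id cm_op" where
  "add_op IMark a = Add_Inv a"
| "add_op RMark a = Add_Res a"

fun marks_of :: "'id cm_op \<Rightarrow> (mark \<times> 'id) list" where
  "marks_of (Add_Inv a) = [(IMark, a)]"
| "marks_of (Add_Res a) = [(RMark, a)]"
| "marks_of _ = []"

lemma marks_of_eq: "(k, a) \<in> set (marks_of x) \<longleftrightarrow> x = add_op k a"
  by (cases x; cases k) auto

lemma cm_next_marks_of: "cm_next S x = S @ marks_of x"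
  by (cases x) auto

text \<open>The state reached consists of \<open>S\<close> and the marks of the operations executed
  so far, so legality can be checked at each index against a prefix of \<open>L\<close> instead of
  by recursion.\<close>

lemma cm_legalI:
  assumes "\<And>j. j < length L \<Longrightarrow>
      cm_requires (S @ concat (map (marks_of \<circ> x) (take j L))) (x (L ! j)) \<and>
      r (L ! j) = cm_return (S @ concat (map (marks_of \<circ> x) (take j L))) (x (L ! j))"
  shows "cm_legal S (map (\<lambda>a. (p a, x a, r a)) L)"
  using assms
proof (induction L arbitrary: S)
  case (Cons a L)
  have "cm_legal (cm_next S (x a)) (map (\<lambda>a. (p a, x a, r a)) L)"
  proof (rule Cons.IH)
    fix j assume "j < length L"
    then show "cm_requires (cm_next S (x a) @ concat (map (marks_of \<circ> x) (take j L))) (x (L ! j)) \<and>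
      r (L ! j) = cm_return (cm_next S (x a) @ concat (map (marks_of \<circ> x) (take j L))) (x (L ! j))"
      using Cons.prems[of "Suc j"] by (simp add: cm_next_marks_of o_def)
  qed
  then show ?case using Cons.prems[of 0] by simp
qed simp

lemma idx_le: "n < length S \<Longrightarrow> S ! n = e \<Longrightarrow> idx e S \<le> enat n"
  by (auto simp: idx_def intro: Least_le)

lemma le_idx:
  assumes "\<And>n. n < length S \<Longrightarrow> S ! n = e \<Longrightarrow> k \<le> n"
  shows "enat k \<le> idx e S"
proof (cases "e \<in> set S")
  case True
  then obtain n where "n < length S \<and> S ! n = e" by (auto simp: in_set_conv_nth)
  from LeastI[where P = "\<lambda>n. n < length S \<and> S ! n = e", OF this] assms True
  show ?thesis by (simp add: idx_def)
qed (simp add: idx_def)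

text \<open>The length of \<open>S\<close> separates the two values; the right one may be
  infinite.\<close>

lemma idx_less_append:
  assumes "e \<in> set S" "e' \<notin> set S"
  shows "idx e (S @ S') < idx e' (S @ S')"
proof -
  obtain n where n: "n < length S" "S ! n = e" using assms(1) by (auto simp: in_set_conv_nth)
  then have "idx e (S @ S') \<le> enat n" by (intro idx_le) (auto simp: nth_append)
  also have "enat n < enat (length S)" using n by simp
  also have "enat (length S) \<le> idx e' (S @ S')"
  proof (rule le_idx)
    fix k assume "(S @ S') ! k = e'"
    then show "length S \<le> k" using assms(2) nth_mem[of k S] by (cases "k < length S") (auto simp: nth_append)
  qed
  finally show ?thesis .
qed

text \<open>Each of the two marks is contributed by a single list entry. Cutting the list right
  after \<open>a\<close> leaves \<open>b\<close> in the second part.\<close>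

lemma idx_less_sorted:
  fixes key :: "'a \<Rightarrow> 'b :: linorder"
  assumes "sorted_wrt (\<lambda>a b. key a < key b) L" "a \<in> set L" "b \<in> set L" "key a < key b"
    and "\<And>c. c \<in> set L \<Longrightarrow> e \<in> set (g c) \<longleftrightarrow> c = a"
    and "\<And>c. c \<in> set L \<Longrightarrow> e' \<in> set (g c) \<longleftrightarrow> c = b"
  shows "idx e (concat (map g L)) < idx e' (concat (map g L))"
proof -
  obtain us vs where L: "L = us @ a # vs" using assms(2) by (auto simp: in_set_conv_decomp)
  have "b \<notin> set us" "b \<noteq> a" using assms(1,4) unfolding L by (auto simp: sorted_wrt_append)
  then have "e' \<notin> set (concat (map g (us @ [a])))"
    using assms(6) unfolding L by auto
  moreover have "e \<in> set (concat (map g (us @ [a])))"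
    using assms(5) unfolding L by auto
  ultimately show ?thesis
    unfolding L using idx_less_append[of e "concat (map g (us @ [a]))" e' "concat (map g vs)"] by simp
qed


section \<open>The simulation invariant\<close>

fun stamp_total :: "stamp_mode \<Rightarrow> nat \<Rightarrow> 'id config \<Rightarrow> nat" where
  "stamp_total FAInc N c = counter c"
| "stamp_total Striped N c = sum (cell c) {1..N}"

lemma stamp_total_update [simp]:
  "stamp_total m N (control_update f c) = stamp_total m N c"
  "stamp_total m N (reg_update g c) = stamp_total m N c"
  by (cases m; simp)+

text \<open>\<open>FAInc\<close> fetches the value before its own increment, whereas the sum in
  \<open>Striped\<close> already contains it. The shift lets both modes be compared with the total
  after the increment.\<close>

fun normal_stamp :: "stamp_mode \<Rightarrow> nat \<Rightarrow> nat" where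
  "normal_stamp FAInc t = Suc t"
| "normal_stamp Striped t = t"

lemma normal_stamp_less_iff [simp]: "normal_stamp m t < normal_stamp m t' \<longleftrightarrow> t < t'"
  by (cases m) auto

lemma normal_stamp_eq_iff [simp]: "normal_stamp m t = normal_stamp m t' \<longleftrightarrow> t = t'"
  by (cases m) auto

fun query_ids :: "'id cm_op \<Rightarrow> 'id set" where
  "query_ids (Precedes a b) = {a, b}"
| "query_ids (Concurrent a b) = {a, b}"
| "query_ids _ = {}"

abbreviation is_query :: "'id cm_op \<Rightarrow> bool" where
  "is_query x \<equiv> query_ids x \<noteq> {}"

text \<open>The list with which \<open>start\<close> enters \<open>Looking\<close>; the invariant
  splits it into the records already found and those still to be found.\<close>

fun query_keys :: "'id cm_op \<Rightarrow> (mark \<times> 'id) list" where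
  "query_keys (Precedes a b) = precedes_keys a b"
| "query_keys (Concurrent a b) = precedes_keys a b @ precedes_keys b a"
| "query_keys _ = []"

lemma add_op_inject [simp]: "add_op k a = add_op k' a' \<longleftrightarrow> k = k' \<and> a = a'"
  by (cases k; cases k') auto

lemma not_query_add_op [simp]: "query_ids (add_op k a) = {}" "query_keys (add_op k a) = []"
  "answer (add_op k a) ts = Ack"
  by (cases k; simp)+

lemma not_query_cases: "\<not> is_query x \<Longrightarrow> \<exists>k a. x = add_op k a"
  by (cases x) (auto intro: exI[of _ IMark] exI[of _ RMark])

text \<open>These are the operations that enter the linearization. An add operation becomes
  effective when its record is written, a query when its answer is computed.\<close>

definition effective :: "('p, 'op, 'ret) history \<Rightarrow> ('p \<Rightarrow> 'id control) \<Rightarrow> 'p \<times> nat \<Rightarrow> bool" where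
  "effective H l a \<longleftrightarrow>
     snd a < n_res (fst a) H \<or> snd a = n_res (fst a) H \<and> (\<exists>r. l (fst a) = Done r)"

text \<open>For an add operation that is still stamping, a lower bound on the normalized timestamp it can
  obtain. It never decreases along an execution.\<close>

fun stamp_bound :: "stamp_mode \<Rightarrow> nat \<Rightarrow> 'id config \<Rightarrow> 'id control \<Rightarrow> nat \<Rightarrow> nat" where
  "stamp_bound m N c (Stamping k a) t = Suc (stamp_total m N c)"
| "stamp_bound m N c (Summing k a U s) t = s + sum (cell c) U"
| "stamp_bound m N c (Writing k a s) t = normal_stamp m s"
| "stamp_bound m N c _ t = t"

text \<open>Only the operation numbered \<open>n_res\<close> of a process can be open; those before
  it have responded and their time is final.\<close>

definition time_bound ::
    "stamp_mode \<Rightarrow> nat \<Rightarrow> ('p, 'op, 'ret) history \<Rightarrow> 'id config \<Rightarrow> ('p \<Rightarrow> 'id control) \<Rightarrow>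
     ('p \<times> nat \<Rightarrow> nat) \<Rightarrow> 'p \<times> nat \<Rightarrow> nat" where
  "time_bound m N H c l tm a =
     (if snd a = n_res (fst a) H then stamp_bound m N c (l (fst a)) (tm a) else tm a)"

text \<open>Expresses by ghost data that some register holds the record \<open>r\<close> with raw
  timestamp \<open>t\<close>. Records are never removed, so this stays true for records a query has
  already looked up.\<close>

definition stamped ::
    "stamp_mode \<Rightarrow> ('p, 'op, 'ret) history \<Rightarrow> ('p \<Rightarrow> 'id control) \<Rightarrow> ('p \<times> nat \<Rightarrow> 'id cm_op) \<Rightarrow>
     ('p \<times> nat \<Rightarrow> nat) \<Rightarrow> mark \<times> 'id \<Rightarrow> nat \<Rightarrow> bool" where
  "stamped m H l opn tm r t \<longleftrightarrow>
     (\<exists>a. effective H l a \<and> opn a = add_op (fst r) (snd r) \<and> tm a = normal_stamp m t)"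

text \<open>In \<open>Summing\<close> the values read so far are at most the present ones because
  cells only grow. Once \<open>U\<close> is empty, this bounds the stamp by the current total, as
  \<open>Writing\<close> demands.\<close>

fun control_ok ::
    "stamp_mode \<Rightarrow> nat \<Rightarrow> 'id config \<Rightarrow> (mark \<times> 'id \<Rightarrow> nat \<Rightarrow> bool) \<Rightarrow> 'id control \<Rightarrow>
     'id cm_op \<Rightarrow> cm_ret \<Rightarrow> bool" where
  "control_ok m N c S Idle x r \<longleftrightarrow> True"
| "control_ok m N c S (Stamping k a) x r \<longleftrightarrow> x = add_op k a"
| "control_ok m N c S (Summing k a U s) x r \<longleftrightarrow>
     x = add_op k a \<and> m = Striped \<and> U \<subseteq> {1..N} \<and> s \<le> sum (cell c) ({1..N} - U)"
| "control_ok m N c S (Writing k a t) x r \<longleftrightarrow>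
     x = add_op k a \<and> normal_stamp m t \<le> stamp_total m N c"
| "control_ok m N c S (Looking y ks U ts) x r \<longleftrightarrow>
     x = y \<and> is_query x \<and> (\<exists>ks'. query_keys x = ks' @ ks \<and> list_all2 S ks' ts)"
| "control_ok m N c S (Done r') x r \<longleftrightarrow> r' = r"

text \<open>Together with the next lemma this covers the processes that do not take the step: their
  control state is unchanged, while counters can only grow and records can only be added.\<close>

lemma stamp_bound_mono:
  assumes "stamp_total m N c \<le> stamp_total m N c'" "\<And>q. cell c q \<le> cell c' q"
  shows "stamp_bound m N c l t \<le> stamp_bound m N c' l t"
  using assms by (cases l) (auto intro: sum_mono)

lemma control_ok_mono:
  assumes "stamp_total m N c \<le> stamp_total m N c'" "\<And>q. cell c q \<le> cell c' q"
    and "\<And>r t. S r t \<Longrightarrow> S' r t"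
    and "control_ok m N c S l x r"
  shows "control_ok m N c' S' l x r"
proof (cases l)
  case (Summing k a U s)
  then show ?thesis using assms(2,4) sum_mono[of "{1..N} - U" "cell c" "cell c'"]
    by (auto intro: order_trans)
next
  case (Looking y ks U ts)
  then show ?thesis using assms(4) list_all2_mono[OF _ assms(3)] by auto
qed (use assms in auto)

text \<open>Ghost data of the operations: \<open>opn\<close> and \<open>ret\<close> are what is invoked and returned, \<open>tm\<close> is the
  normalized timestamp of an add operation, and for a query the total of the counter at its
  invocation, and \<open>pos\<close> is the position of the invocation in the history.\<close>

locale simulation =
  fixes m :: stamp_mode and N :: nat and H :: "(nat, 'id cm_op, cm_ret) history"
    and c :: "'id config"
    and opn :: "nat \<times> nat \<Rightarrow> 'id cm_op" and ret :: "nat \<times> nat \<Rightarrow> cm_ret"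
    and tm pos :: "nat \<times> nat \<Rightarrow> nat"
  assumes wf: "well_formed H"
    and counts: "n_inv p H = n_res p H + (if control c p = Idle then 0 else 1)"
    and processes: "p \<notin> {1..N} \<Longrightarrow> n_inv p H = 0"
    and history: "filter (\<lambda>e. proc e = p) H =
        events_of (map (\<lambda>i. (p, opn (p, i), ret (p, i))) [0..<n_res p H]) @
        (if control c p = Idle then [] else [Inv p (opn (p, n_res p H))])"
    and pos_less: "a \<in> operations H \<Longrightarrow> pos a < length H"
    and pos_inj: "inj_on pos (operations H)"
    and control: "control_ok m N c (stamped m H (control c) opn tm) (control c p)
        (opn (p, n_res p H)) (ret (p, n_res p H))"
    and unique: "a \<in> operations H \<Longrightarrow> b \<in> operations H \<Longrightarrow> opn a = add_op k x \<Longrightarrow>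
        opn b = add_op k x \<Longrightarrow> a = b"
    and invoked_before: "(p, n) \<in> operations H \<Longrightarrow> opn (p, n) = Add_Res x \<Longrightarrow>
        \<exists>n'<n. opn (p, n') = Add_Inv x"
    and registers: "(k, x, t) \<in> set (reg c q) \<longleftrightarrow>
        (\<exists>n. effective H (control c) (q, n) \<and> opn (q, n) = add_op k x \<and>
             tm (q, n) = normal_stamp m t)"
    and tm_le: "effective H (control c) a \<or> a \<in> operations H \<and> is_query (opn a) \<Longrightarrow>
        tm a \<le> stamp_total m N c"
    and order: "op_less H a b \<Longrightarrow> pos a < pos b \<and>
        (if is_query (opn b) then tm a \<le> tm b else tm a < time_bound m N H c (control c) tm b)"
    and query_written: "a \<in> operations H \<Longrightarrow> x \<in> query_ids (opn a) \<Longrightarrow>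
        \<exists>b. effective H (control c) b \<and> opn b = Add_Res x \<and> tm b \<le> tm a"
    and returned: "effective H (control c) a \<Longrightarrow>
        \<exists>ts. list_all2 (stamped m H (control c) opn tm) (query_keys (opn a)) ts \<and>
             ret a = answer (opn a) ts"
begin

lemma effective_operations: "effective H (control c) a \<Longrightarrow> a \<in> operations H"
  using counts[of "fst a"] by (auto simp: effective_def operations_iff)

text \<open>Translates the obligations of the callers, which speak of events in \<open>H\<close>,
  into statements about ghost operations.\<close>

lemma Inv_in_history: "Inv p x \<in> set H \<longleftrightarrow> (\<exists>n. (p, n) \<in> operations H \<and> opn (p, n) = x)"
proof -
  have "Inv p x \<in> set H \<longleftrightarrow> Inv p x \<in> set (filter (\<lambda>e. proc e = p) H)" by simp
  also have "\<dots> \<longleftrightarrow> (\<exists>n < n_inv p H. opn (p, n) = x)"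
    unfolding history using counts[of p] by (auto simp: events_of_def less_Suc_eq)
  finally show ?thesis by (auto simp: operations_iff)
qed

end

section \<open>Preservation of the invariant by every transition\<close>

lemma simulation_init:
  "simulation m N [] init_config (\<lambda>_. undefined) (\<lambda>_. Ack) (\<lambda>_. 0) (\<lambda>_. 0)"
proof
qed (auto simp: init_config_def well_formed_def operations_iff effective_def op_less_def res_at_def inj_on_def)

text \<open>An idle process has as many invocations as responses, so \<open>n_res p H\<close> is the
  number of the new operation. For a query the current total is its final time; for an add operation
  it is a placeholder until the record is written.\<close>

lemma (in simulation) simulation_invoke:
  assumes "p \<in> {1..N}" "control c p = Idle" "may_call H c p x" "well_formed (H @ [Inv p x])"
  shows "simulation m N (H @ [Inv p x]) (goto p (start N x) c) (opn((p, n_res p H) := x)) ret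
      (tm((p, n_res p H) := stamp_total m N c)) (pos((p, n_res p H) := length H))"
proof -
  let ?a = "(p, n_res p H)"
  let ?H = "H @ [Inv p x]" and ?c = "goto p (start N x) c"
  let ?opn = "opn(?a := x)" and ?tm = "tm(?a := stamp_total m N c)" and ?pos = "pos(?a := length H)"
  have n_inv: "n_inv p H = n_res p H"
    using counts[of p] assms(2) by simp
  have start: "start N x \<noteq> Idle" "start N x \<noteq> Done r" for r
    by (cases x; simp)+
  have start_add: "start N (add_op k y) = Stamping k y" for k y
    by (cases k) simp_all
  have eff: "effective ?H (control ?c) = effective H (control c)"
    using start assms(2) by (auto simp: effective_def goto_def fun_eq_iff)
  have new: "?a \<notin> operations H"
    using n_inv by (simp add: operations_iff)
  have ops: "operations ?H = insert ?a (operations H)"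
    using n_inv by (auto simp: operations_iff split: if_splits)
  have eff_new: "effective H (control c) b \<Longrightarrow> b \<noteq> ?a" for b
    using effective_operations new by blast
  have total: "stamp_total m N ?c = stamp_total m N c"
    by (cases m) (auto simp: goto_def)
  have stamped: "stamped m ?H (control ?c) ?opn ?tm = stamped m H (control c) opn tm"
    using eff_new by (auto simp: stamped_def eff fun_eq_iff split: if_splits)
  \<comment> \<open>\<open>goto\<close> leaves the counters alone, so monotonicity applies in both
    directions.\<close>
  have bound_eq: "stamp_bound m N ?c l t = stamp_bound m N c l t" for l t
    by (intro antisym stamp_bound_mono) (simp_all add: total, simp_all add: goto_def)
  have bound: "time_bound m N ?H ?c (control ?c) ?tm b = time_bound m N H c (control c) tm b"
    if "b \<in> operations H" for b
    using that new assms(2) n_inv bound_eq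
    by (cases b) (auto simp: time_bound_def operations_iff goto_def)
  have unique_new: "b \<notin> operations H" if "x = add_op k y" "opn b = add_op k y" for b k y
  proof
    assume "b \<in> operations H"
    then have "Inv (fst b) x \<in> set H"
      using that by (subst Inv_in_history) (metis prod.collapse)
    then show False using assms(3) that by (cases k) auto
  qed
  show ?thesis
  proof (unfold_locales, goal_cases)
    case 1 show ?case by (rule assms(4))
  next
    case (2 q) then show ?case using counts[of q] assms(2) start by (auto simp: goto_def)
  next
    case (3 q) then show ?case using processes[of q] assms(1) by auto
  next
    case (4 q)
    have "map (\<lambda>i. (q, ?opn (q, i), ret (q, i))) [0..<n_res q H] =
        map (\<lambda>i. (q, opn (q, i), ret (q, i))) [0..<n_res q H]"
      by auto
    then show ?case
      using history[of q] assms(2) start by (auto simp: goto_def simp del: map_eq_conv)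
  next
    case (5 a) then show ?case using pos_less[of a] by (auto simp: ops)
  next
    case 6
    have "inj_on ?pos (operations H)"
      using pos_inj new by (simp add: inj_on_fun_updI inj_on_def)
    moreover have "length H \<notin> pos ` operations H" using pos_less by (metis imageE less_irrefl)
    ultimately show ?case using new by (auto simp: ops)
  next
    case (7 q)
    show ?case
    proof (cases "q = p")
      case True
      then show ?thesis by (cases x) (auto simp: goto_def)
    next
      case False
      then show ?thesis
        unfolding stamped using control_ok_mono[OF _ _ _ control[of q], of ?c] total
        by (auto simp: goto_def)
    qed
  next
    case (8 a b k y)
    then show ?case using unique[of a b k y] unique_new[of k y]
      by (auto simp: ops split: if_splits)
  next
    case (9 q n y)
    show ?case
    proof (cases "(q, n) = ?a")
      case True
      then have "Inv p (Add_Inv y) \<in> set H" using 9 assms(3) by simp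
      then obtain n' where "(p, n') \<in> operations H" "opn (p, n') = Add_Inv y"
        by (auto simp: Inv_in_history)
      then show ?thesis using True n_inv by (intro exI[of _ n']) (auto simp: operations_iff)
    next
      case False
      then obtain n' where "n' < n" "opn (q, n') = Add_Inv y"
        using invoked_before[of q n y] 9 by (auto simp: ops)
      then show ?thesis
        using False 9 n_inv by (intro exI[of _ n']) (auto simp: operations_iff)
    qed
  next
    case (10 k y t q)
    have "reg ?c = reg c" by (simp add: goto_def)
    then show ?case using registers[of k y t q] eff_new by (auto simp: eff split: if_splits)
  next
    case (11 a) then show ?case
      using tm_le[of a] by (cases "a = ?a") (simp_all add: ops total eff)
  next
    case (12 a b)
    show ?case
    proof (cases "op_less H a b")
      case True
      then have "a \<in> operations H" "b \<in> operations H"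
        using op_less_completed[OF True] op_less_invoked[OF True] counts[of "fst a"]
        by (auto simp: operations_iff)
      then show ?thesis using order[OF True] new bound[of b] by auto
    next
      case False
      then have *: "b = ?a" "snd a < n_res (fst a) H"
        using 12 n_inv by (auto simp: op_less_snoc_Inv)
      \<comment> \<open>A completed operation has a time of at most the current total. A new query
        receives this total, hence the weak inequality; a new add operation starts with a bound one
        larger, hence the strict one.\<close>
      then have "effective H (control c) a" by (simp add: effective_def)
      then have a: "tm a \<le> stamp_total m N c" "pos a < length H" "a \<noteq> ?a"
        using tm_le pos_less effective_operations eff_new by blast+
      show ?thesis
      proof (cases "is_query x")
        case True
        then show ?thesis using a * by auto
      next
        case False
        then obtain k y where "x = add_op k y" using not_query_cases by blast
        then have "time_bound m N ?H ?c (control ?c) ?tm b = Suc (stamp_total m N c)"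
          using total by (simp add: time_bound_def * start_add) (simp add: goto_def start_add)
        then show ?thesis using a * False by auto
      qed
    qed
  next
    case (13 a y)
    show ?case
    proof (cases "a = ?a")
      case True
      \<comment> \<open>The caller's obligation yields a record in a register, and by
        \<open>registers\<close> an effective operation that wrote it. Its time is at most the
        current total, which is the time of the new query.\<close>
      then have "written c RMark y" using 13 assms(3) by (cases x) auto
      then obtain q t where "(RMark, y, t) \<in> set (reg c q)" by (auto simp: written_def)
      then obtain n where "effective H (control c) (q, n)" "opn (q, n) = Add_Res y"
        by (auto simp: registers)
      moreover from this have "tm (q, n) \<le> stamp_total m N c" using tm_le by blast
      ultimately show ?thesis
        using True eff_new[of "(q, n)"] by (intro exI[of _ "(q, n)"]) (auto simp: eff)
    next
      case False
      then obtain b where "effective H (control c) b" "opn b = Add_Res y" "tm b \<le> tm a"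
        using query_written[of a y] 13 by (auto simp: ops)
      then show ?thesis using False eff_new[of b] by (intro exI[of _ b]) (auto simp: eff)
    qed
  next
    case (14 a) then show ?case using returned[of a] eff_new[of a] by (auto simp: stamped eff)
  qed
qed

text \<open>The operation was already effective in state \<open>Done\<close>, so the set of
  effective operations and all ghost data stay the same.\<close>

lemma (in simulation) simulation_respond:
  assumes "p \<in> {1..N}" "control c p = Done r" "well_formed (H @ [Res p r])"
  shows "simulation m N (H @ [Res p r]) (goto p Idle c) opn ret tm pos"
proof -
  let ?H = "H @ [Res p r]" and ?c = "goto p Idle c"
  have eff: "effective ?H (control ?c) = effective H (control c)"
    using assms(2) by (auto simp: effective_def goto_def fun_eq_iff)
  have ops: "operations ?H = operations H"
    by (auto simp: operations_iff)
  have total: "stamp_total m N ?c = stamp_total m N c"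
    by (cases m) (auto simp: goto_def)
  have bound: "time_bound m N ?H ?c (control ?c) tm a = time_bound m N H c (control c) tm a"
    if "a \<in> operations H" for a
  proof -
    have "stamp_bound m N ?c l t = stamp_bound m N c l t" for l t
      by (intro antisym stamp_bound_mono) (simp_all add: total, simp_all add: goto_def)
    then show ?thesis
      using that assms(2) counts[of p]
      by (cases a) (auto simp: time_bound_def operations_iff goto_def)
  qed
  have stamped: "stamped m ?H (control ?c) opn tm = stamped m H (control c) opn tm"
    by (simp add: stamped_def eff fun_eq_iff)
  show ?thesis
  proof (unfold_locales, goal_cases)
    case 1 show ?case by (rule assms(3))
  next
    case (2 q) then show ?case using counts[of q] assms(2) by (auto simp: goto_def)
  next
    case (3 q) then show ?case using processes[of q] by simp
  next
    case (4 q) then show ?case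
      using history[of q] control[of p] assms(2) by (auto simp: goto_def events_of_append)
  next
    case (5 a) then show ?case using pos_less[of a] by (simp add: ops)
  next
    case 6 then show ?case using pos_inj by (simp add: ops)
  next
    case (7 q) then show ?case
      unfolding stamped using control_ok_mono[OF _ _ _ control[of q], of ?c] total
      by (auto simp: goto_def)
  next
    case (8 a b k x) then show ?case using unique by (simp add: ops)
  next
    case (9 q n x) then show ?case using invoked_before by (simp add: ops)
  next
    case (10 k x t q) then show ?case using registers by (simp add: eff) (simp add: goto_def)
  next
    case (11 a) then show ?case using tm_le by (simp add: ops total eff)
  next
    case (12 a b) then show ?case
      using order[of a b] bound[of b] by (simp add: op_less_snoc_Res operations_iff op_less_invoked)
  next
    case (13 a x) then show ?case using query_written by (simp add: ops eff)
  next
    case (14 a) then show ?case using returned by (simp add: stamped eff)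
  qed
qed

text \<open>Handles the steps after which the operation is still not effective. The order is kept
  because the lower bound on the future stamp does not decrease.\<close>

lemma (in simulation) simulation_continue:
  assumes "control c p \<noteq> Idle" "\<And>r. control c p \<noteq> Done r" "l \<noteq> Idle" "\<And>r. l \<noteq> Done r"
    and "control c' = (control c)(p := l)" "reg c' = reg c"
    and total: "stamp_total m N c \<le> stamp_total m N c'" and cell: "\<And>q. cell c q \<le> cell c' q"
    and ok: "control_ok m N c' (stamped m H (control c) opn tm) l
        (opn (p, n_res p H)) (ret (p, n_res p H))"
    and bound: "\<And>t. stamp_bound m N c (control c p) t \<le> stamp_bound m N c' l t"
  shows "simulation m N H c' opn ret tm pos"
proof -
  have eff: "effective H (control c') = effective H (control c)"
    using assms(1-5) by (auto simp: effective_def fun_eq_iff)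
  have stamped: "stamped m H (control c') opn tm = stamped m H (control c) opn tm"
    by (simp add: stamped_def eff fun_eq_iff)
  have time: "time_bound m N H c (control c) tm a \<le> time_bound m N H c' (control c') tm a" for a
    using bound stamp_bound_mono[OF total cell] by (simp add: time_bound_def assms(5))
  show ?thesis
  proof (unfold_locales, goal_cases)
    case 1 show ?case by (rule wf)
  next
    case (2 q) then show ?case using counts[of q] assms(1-5) by auto
  next
    case (3 q) then show ?case by (rule processes)
  next
    case (4 q) then show ?case using history[of q] assms(1-5) by auto
  next
    case (5 a) then show ?case by (rule pos_less)
  next
    case 6 then show ?case by (rule pos_inj)
  next
    case (7 q) then show ?case
      unfolding stamped
      using control_ok_mono[OF total cell _ control[of q]] ok by (auto simp: assms(5))
  next
    case (8 a b k x) then show ?case by (rule unique)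
  next
    case (9 q n x) then show ?case by (rule invoked_before)
  next
    case (10 k x t q) then show ?case using registers by (simp add: eff assms(6))
  next
    case (11 a) then show ?case using tm_le[of a] total by (auto simp: eff)
  next
    case (12 a b) then show ?case
      using order[of a b] time[of b] by (auto split: if_splits)
  next
    case (13 a x) then show ?case using query_written by (simp add: eff)
  next
    case (14 a) then show ?case using returned by (simp add: stamped eff)
  qed
qed

text \<open>Handles the two steps that make an operation effective: writing a record, where
  \<open>t\<close> is the normalized stamp, and answering a query, where \<open>t\<close> is the
  time fixed at the invocation. For a query the second alternative in the register condition is
  false, as no \<open>add_op\<close> is a query.\<close>

lemma (in simulation) simulation_finish:
  assumes "control c p \<noteq> Idle" "\<And>r. control c p \<noteq> Done r"
    and "counter c' = counter c" "cell c' = cell c" "control c' = (control c)(p := Done r)"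
    and reg: "\<And>k x s q. (k, x, s) \<in> set (reg c' q) \<longleftrightarrow> (k, x, s) \<in> set (reg c q) \<or>
        q = p \<and> opn (p, n_res p H) = add_op k x \<and> t = normal_stamp m s"
    and t: "t \<le> stamp_total m N c" "is_query (opn (p, n_res p H)) \<Longrightarrow> t = tm (p, n_res p H)"
      "\<not> is_query (opn (p, n_res p H)) \<Longrightarrow>
        stamp_bound m N c (control c p) (tm (p, n_res p H)) \<le> t"
    and ts: "list_all2 (stamped m H (control c) opn tm) (query_keys (opn (p, n_res p H))) ts"
    and r: "r = answer (opn (p, n_res p H)) ts"
  shows "simulation m N H c' opn (ret((p, n_res p H) := r)) (tm((p, n_res p H) := t)) pos"
proof -
  let ?a = "(p, n_res p H)"
  let ?ret = "ret(?a := r)" and ?tm = "tm(?a := t)"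
  have eff: "effective H (control c') b \<longleftrightarrow> b = ?a \<or> effective H (control c) b" for b
    using assms(1,2,5) by (cases b) (auto simp: effective_def)
  have eff_new: "effective H (control c) b \<Longrightarrow> b \<noteq> ?a" for b
    using assms(2) by (auto simp: effective_def)
  have a: "?a \<in> operations H"
    using counts[of p] assms(1) by (simp add: operations_iff)
  have total: "stamp_total m N c' = stamp_total m N c"
    using assms(3,4) by (cases m) auto
  have stamped: "stamped m H (control c') opn ?tm k u"
    if "stamped m H (control c) opn tm k u" for k u
    using that eff_new unfolding stamped_def eff by (metis fun_upd_other)
  have stamped_all: "list_all2 (stamped m H (control c') opn ?tm) ks us"
    if "list_all2 (stamped m H (control c) opn tm) ks us" for ks us
    using that by (rule list_all2_mono) (rule stamped)
  have bound_eq: "stamp_bound m N c' l u = stamp_bound m N c l u" for l u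
    by (intro antisym stamp_bound_mono) (simp_all add: total assms(4))
  have bound: "time_bound m N H c (control c) tm b \<le> time_bound m N H c' (control c') ?tm b"
    if "\<not> is_query (opn b)" for b
    using that t(3) bound_eq by (cases b) (auto simp: time_bound_def assms(5))
  show ?thesis
  proof (unfold_locales, goal_cases)
    case 1 show ?case by (rule wf)
  next
    case (2 q) then show ?case using counts[of q] assms(1,5) by auto
  next
    case (3 q) then show ?case by (rule processes)
  next
    case (4 q)
    have "map (\<lambda>i. (q, opn (q, i), ?ret (q, i))) [0..<n_res q H] =
        map (\<lambda>i. (q, opn (q, i), ret (q, i))) [0..<n_res q H]"
      by auto
    then show ?case using history[of q] assms(1,5) by (auto simp del: map_eq_conv)
  next
    case (5 a) then show ?case by (rule pos_less)
  next
    case 6 then show ?case by (rule pos_inj)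
  next
    case (7 q) then show ?case
      using control_ok_mono[OF _ _ stamped control[of q], of c'] total
      by (auto simp: assms(4,5))
  next
    case (8 a b k x) then show ?case by (rule unique)
  next
    case (9 q n x) then show ?case by (rule invoked_before)
  next
    case (10 k x s q) then show ?case
      using registers[of k x s q] eff_new by (auto simp: eff reg)
  next
    case (11 b) then show ?case using tm_le[of b] t(1) by (auto simp: eff total)
  next
    case (12 b d)
    \<comment> \<open>An operation that precedes another one has responded, which \<open>?a\<close>
      has not.\<close>
    then have "b \<noteq> ?a" using op_less_completed by fastforce
    then show ?case
      using order[OF 12] bound[of d] t(2) by (auto split: if_splits)
  next
    case (13 b x)
    then obtain d where "effective H (control c) d" "opn d = Add_Res x" "tm d \<le> tm b"
      using query_written by blast
    then show ?case using eff_new[of d] t(2) 13 by (intro exI[of _ d]) (auto simp: eff)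
  next
    case (14 b)
    show ?case
    proof (cases "b = ?a")
      case True
      then show ?thesis using stamped_all[OF ts] r by auto
    next
      case False
      then show ?thesis using 14 returned[of b] stamped_all by (auto simp: eff)
    qed
  qed
qed

lemma (in simulation) simulation_step:
  assumes "step m N p c c'" "p \<in> {1..N}"
  shows "\<exists>ret tm. simulation m N H c' opn ret tm pos"
  using assms(1)
proof cases
  case (fetch_inc k a)
  \<comment> \<open>The bound of \<open>Stamping\<close>, one more than the counter, is exactly the
    normalized fetched value.\<close>
  have "simulation m N H c' opn ret tm pos"
    by (rule simulation_continue[where p = p and l = "Writing k a (counter c)"])
      (use control[of p] fetch_inc in \<open>auto simp: goto_def\<close>)
  then show ?thesis by blast
next
  case (incr_cell k a)
  \<comment> \<open>The own cell is among those to be summed. So the old bound, one more than the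
    total, equals the sum of all cells after the increment, none of which has been read yet.\<close>
  have "sum ((cell c)(p := Suc (cell c p))) {1..N} = Suc (sum (cell c) {1..N})"
  proof -
    have "(cell c)(p := Suc (cell c p)) = (\<lambda>q. cell c q + (if q = p then 1 else 0))" by auto
    then show ?thesis using assms(2) by (simp only: sum.distrib sum.delta) simp
  qed
  then have "simulation m N H c' opn ret tm pos"
    by (intro simulation_continue[where p = p and l = "Summing k a {1..N} 0"])
      (use control[of p] incr_cell in \<open>auto simp: goto_def\<close>)
  then show ?thesis by blast
next
  case (read_cell k a U s q)
  then have U: "U \<subseteq> {1..N}" "s \<le> sum (cell c) ({1..N} - U)" "opn (p, n_res p H) = add_op k a"
      "m = Striped"
    using control[of p] by auto
  then have "finite U" by (meson finite_atLeastAtMost finite_subset)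
  \<comment> \<open>The value read moves from the unread cells into \<open>s\<close>, so the lower
    bound is unchanged by the read.\<close>
  then have sum: "sum (cell c) U = cell c q + sum (cell c) (U - {q})"
    using read_cell by (simp add: sum.remove)
  have "{1..N} - (U - {q}) = insert q ({1..N} - U)" using U read_cell by auto
  then have "s + cell c q \<le> sum (cell c) ({1..N} - (U - {q}))"
    using U read_cell by simp
  then have "simulation m N H c' opn ret tm pos"
    using U sum
    by (intro simulation_continue[where p = p and l = "Summing k a (U - {q}) (s + cell c q)"])
      (use read_cell in \<open>auto simp: goto_def\<close>)
  then show ?thesis by blast
next
  case (sum_done k a s)
  have "simulation m N H c' opn ret tm pos"
    by (rule simulation_continue[where p = p and l = "Writing k a s"])
      (use control[of p] sum_done in \<open>auto simp: goto_def\<close>)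
  then show ?thesis by blast
next
  case (write_record k a t)
  have "simulation m N H c' opn (ret((p, n_res p H) := Ack))
      (tm((p, n_res p H) := normal_stamp m t)) pos"
    by (rule simulation_finish[where ts = "[]" and p = p])
      (use control[of p] write_record in \<open>auto simp: goto_def\<close>)
  then show ?thesis by blast
next
  case (lookup_hit x k a ks U ts q t)
  then have "stamped m H (control c) opn tm (k, a) t"
    using registers[of k a t q] by (auto simp: stamped_def)
  moreover obtain ks' where "query_keys x = ks' @ (k, a) # ks"
      "list_all2 (stamped m H (control c) opn tm) ks' ts"
    using control[of p] lookup_hit by auto
  ultimately have "\<exists>ks'. query_keys x = ks' @ ks \<and>
      list_all2 (stamped m H (control c) opn tm) ks' (ts @ [t])"
    by (intro exI[of _ "ks' @ [(k, a)]"]) (simp add: list_all2_appendI)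
  then have "simulation m N H c' opn ret tm pos"
    by (intro simulation_continue[where p = p and l = "Looking x ks {1..N} (ts @ [t])"])
      (use control[of p] lookup_hit in \<open>auto simp: goto_def\<close>)
  then show ?thesis by blast
next
  case (lookup_miss x k a ks U ts q)
  have "simulation m N H c' opn ret tm pos"
    by (rule simulation_continue[where p = p and l = "Looking x ((k, a) # ks) (U - {q}) ts"])
      (use control[of p] lookup_miss in \<open>auto simp: goto_def\<close>)
  then show ?thesis by blast
next
  case (lookup_done x U ts)
  let ?a = "(p, n_res p H)"
  have x: "opn ?a = x" "is_query x" "list_all2 (stamped m H (control c) opn tm) (query_keys x) ts"
    using control[of p] lookup_done by auto
  have "?a \<in> operations H"
    using counts[of p] lookup_done by (simp add: operations_iff)
  then have "tm ?a \<le> stamp_total m N c" using tm_le x by blast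
  \<comment> \<open>The trivial update of \<open>tm\<close> matches the form of
    \<open>simulation_finish\<close>: a query keeps the time of its invocation.\<close>
  then have "simulation m N H c' opn (ret(?a := answer x ts)) (tm(?a := tm ?a)) pos"
    using x by (intro simulation_finish[where ts = ts and p = p])
      (use lookup_done in \<open>auto simp: goto_def\<close>)
  then show ?thesis by blast
qed

lemma execution_simulation:
  "execution m N H c \<Longrightarrow> \<exists>opn ret tm pos. simulation m N H c opn ret tm pos"
proof (induction rule: execution.induct)
  case init
  show ?case using simulation_init by blast
next
  case (invoke H c p x)
  have "H @ [Inv p x] \<in> monitor_histories m N"
    using execution.invoke[OF invoke.hyps] unfolding monitor_histories_def by blast
  then have "well_formed (H @ [Inv p x])"
    by (rule monitor_histories_well_formed)
  then show ?case using invoke simulation.simulation_invoke by blast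
next
  case (internal H c p c')
  then show ?case using simulation.simulation_step by metis
next
  case (respond H c p r)
  have "H @ [Res p r] \<in> monitor_histories m N"
    using execution.respond[OF respond.hyps] unfolding monitor_histories_def by blast
  then have "well_formed (H @ [Res p r])"
    by (rule monitor_histories_well_formed)
  then show ?case using respond simulation.simulation_respond by blast
qed

section \<open>The linearization\<close>

fun kind :: "'id cm_op \<Rightarrow> nat" where
  "kind (Add_Inv a) = 0"
| "kind (Add_Res a) = 1"
| "kind _ = 2"

lemma kind_le: "is_query y \<Longrightarrow> kind x \<le> kind y"
  by (cases x; cases y) auto

lemma kind_less: "is_query y \<Longrightarrow> kind (add_op k a) < kind y"
  by (cases k; cases y) auto

lemma filter_concat_map:
  assumes "distinct xs" "\<And>x e. e \<in> set (f x) \<Longrightarrow> g e = x"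
  shows "filter (\<lambda>e. g e = p) (concat (map f xs)) = (if p \<in> set xs then f p else [])"
proof -
  have "filter (\<lambda>e. g e = p) (f x) = (if p = x then f x else [])" for x
    using assms(2)[of _ x] by (auto intro: filter_True filter_False)
  then show ?thesis using assms(1) by (induction xs) auto
qed

context simulation
begin

text \<open>In \<open>Striped\<close> mode distinct operations can obtain the same timestamp. An invocation record then
  precedes a response record, so that \<open>Precedes\<close>, which compares strictly, is false; queries follow
  all records whose timestamp is at most the total they have seen.\<close>

definition key :: "nat \<times> nat \<Rightarrow> nat \<times> nat \<times> nat" where
  "key a = (tm a, kind (opn a), pos a)"

text \<open>For an effective \<open>b\<close> the bound is its actual time. If \<open>b\<close> is
  an add operation, the times already differ; if it is a query, a tie is settled by
  \<open>kind\<close>, which is largest for queries, and then by \<open>pos\<close>.\<close>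

lemma op_less_key:
  assumes "op_less H a b" "effective H (control c) b"
  shows "key a < key b"
proof -
  have "time_bound m N H c (control c) tm b = tm b"
    using assms(2) by (auto simp: time_bound_def effective_def)
  then show ?thesis
    using order[OF assms(1)] kind_le[of "opn b" "opn a"]
    by (auto simp: key_def split: if_splits)
qed

text \<open>The effective operations of a process form an initial segment of its operations, and
  sequential execution orders them in real time.\<close>

lemma same_process_key:
  assumes "effective H (control c) (p, j)" "i < j"
  shows "effective H (control c) (p, i)" "key (p, i) < key (p, j)"
proof -
  show "effective H (control c) (p, i)" using assms by (auto simp: effective_def)
  have "j < n_inv p H" using effective_operations[OF assms(1)] by (simp add: operations_iff)
  then show "key (p, i) < key (p, j)"
    using assms op_less_same_process[OF wf] op_less_key by blast
qed

lemma key_inj: "inj_on key (Collect (effective H (control c)))"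
  using pos_inj effective_operations by (auto simp: inj_on_def key_def)

lemma finite_effective: "finite (Collect (effective H (control c)))"
proof (rule finite_subset)
  show "Collect (effective H (control c)) \<subseteq> (SIGMA p:{1..N}. {..<n_inv p H})"
  proof
    fix a assume "a \<in> Collect (effective H (control c))"
    then have "snd a < n_inv (fst a) H" using effective_operations by (auto simp: operations_iff)
    then show "a \<in> (SIGMA p:{1..N}. {..<n_inv p H})"
      using processes[of "fst a"] by (cases a) force
  qed
qed simp

text \<open>\<open>key\<close> is injective on effective operations, so sorting any enumeration of
  them gives a strictly increasing list.\<close>

definition lin :: "(nat \<times> nat) list" where
  "lin = sort_key key (SOME L. distinct L \<and> set L = Collect (effective H (control c)))"

lemma set_lin: "set lin = Collect (effective H (control c))"
  and sorted_lin: "sorted_wrt (\<lambda>a b. key a < key b) lin"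
proof -
  let ?L = "SOME L. distinct L \<and> set L = Collect (effective H (control c))"
  have "\<exists>L. distinct L \<and> set L = Collect (effective H (control c))"
    using finite_distinct_list[OF finite_effective] by blast
  from someI_ex[OF this] have L: "distinct ?L" "set ?L = Collect (effective H (control c))"
    by blast+
  then show set: "set lin = Collect (effective H (control c))"
    by (simp add: lin_def)
  have "distinct lin" using L by (simp add: lin_def)
  then have "distinct (map key lin)" using key_inj by (simp add: distinct_map set)
  then have "sorted_wrt (<) (map key lin)" by (simp add: strict_sorted_iff lin_def)
  then show "sorted_wrt (\<lambda>a b. key a < key b) lin" by (simp add: sorted_wrt_map)
qed

definition n_effective :: "nat \<Rightarrow> nat" where
  "n_effective p = n_res p H + (if \<exists>r. control c p = Done r then 1 else 0)"

lemma effective_iff: "effective H (control c) (p, n) \<longleftrightarrow> n < n_effective p"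
  by (auto simp: effective_def n_effective_def)

text \<open>Both lists are strictly increasing under \<open>key\<close> and have the same elements,
  and \<open>key\<close> is injective on these.\<close>

lemma lin_projection: "filter (\<lambda>a. fst a = p) lin = map (Pair p) [0..<n_effective p]"
proof -
  let ?A = "filter (\<lambda>a. fst a = p) lin" and ?B = "map (Pair p) [0..<n_effective p]"
  have sets: "set ?A = set ?B"
  proof (rule set_eqI)
    fix a :: "nat \<times> nat"
    show "a \<in> set ?A \<longleftrightarrow> a \<in> set ?B"
      using effective_iff[of "fst a" "snd a"] by (cases a) (simp add: set_lin image_iff, blast)
  qed
  have "sorted_wrt (<) (map key ?A)"
    unfolding sorted_wrt_map by (rule sorted_wrt_filter[OF sorted_lin])
  moreover have "sorted_wrt (<) (map key ?B)"
    unfolding sorted_wrt_map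
  proof (rule sorted_wrt_mono_rel[OF _ sorted_wrt_upt])
    fix i j assume "i \<in> set [0..<n_effective p]" "j \<in> set [0..<n_effective p]" "i < j"
    then show "key (p, i) < key (p, j)"
      using effective_iff by (intro same_process_key(2)) simp_all
  qed
  ultimately have "map key ?B = map key ?A"
    by (rule strict_sorted_equal) (simp only: set_map[of key] sets)
  moreover have "inj_on key (set ?A \<union> set ?B)"
    unfolding sets[symmetric] by (rule inj_on_subset[OF key_inj]) (auto simp: set_lin)
  ultimately show ?thesis by (intro map_inj_on[of key]) simp_all
qed

sublocale numbered lin "\<lambda>a. (opn a, ret a)" n_effective
  by standard (rule lin_projection)

section \<open>Completion, real-time order and legality of the linearization\<close>

lemma seq_hist_projection:
  "filter (\<lambda>e. proc e = p) (events_of seq_hist) =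
   events_of (map (\<lambda>i. (p, opn (p, i), ret (p, i))) [0..<n_effective p])"
  by (simp add: events_of_projection filter_map o_def lin_projection)

text \<open>Pending invocations that are not effective are dropped, and each process in state
  \<open>Done\<close> receives its response. There is at most one such response per process, so
  listing them by process number is compatible with equivalence.\<close>

lemma seq_hist_completion: "\<exists>H'. completion H H' \<and> equivalent (events_of seq_hist) H'"
proof -
  define D where "D = {i. \<exists>a. inv_at H a i \<and> pending H a \<and> \<not> effective H (control c) a}"
  define resp :: "nat \<Rightarrow> (nat, 'id cm_op, cm_ret) history" where
    "resp p = (case control c p of Done r \<Rightarrow> [Res p r] | _ \<Rightarrow> [])" for p
  define Rs where "Rs = concat (map resp [1..<Suc N])"
  have resp: "e \<in> set (resp p) \<Longrightarrow> \<exists>r. e = Res p r" for e p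
    by (auto simp: resp_def split: control.splits)
  \<comment> \<open>A process outside the range never invokes anything and stays idle, so
    \<open>Rs\<close> contains all the responses required.\<close>
  have outside: "resp p = []" if "p \<notin> {1..N}" for p
    using processes[OF that] counts[of p] by (auto simp: resp_def split: control.splits if_splits)
  have Rs: "filter (\<lambda>e. proc e = p) Rs = resp p" for p
  proof -
    have "filter (\<lambda>e. proc e = p) Rs = (if p \<in> set [1..<Suc N] then resp p else [])"
      unfolding Rs_def using resp by (intro filter_concat_map) fastforce+
    then show ?thesis using outside[of p] by auto
  qed
  \<comment> \<open>The only possible pending operation of \<open>p\<close> is the one numbered
    \<open>n_res p H\<close>, which leaves a single candidate for an event of \<open>p\<close> in
    \<open>D\<close>.\<close>
  have D: "i \<in> D \<longleftrightarrow>
      \<not> effective H (control c) (p, n_res p H) \<and> control c p \<noteq> Idle \<and> inv_at H (p, n_res p H) i"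
    if "proc (H ! i) = p" for i p
  proof -
    have "fst a = p" if "inv_at H a i" for a
      using that \<open>proc (H ! i) = p\<close> by (auto simp: inv_at_def)
    moreover have "pending H a \<longleftrightarrow> a = (fst a, n_res (fst a) H) \<and> control c (fst a) \<noteq> Idle" for a
      using counts[of "fst a"] by (cases a) (auto simp: pending_iff)
    ultimately have "inv_at H a i \<and> pending H a \<longleftrightarrow>
        a = (p, n_res p H) \<and> control c p \<noteq> Idle \<and> inv_at H (p, n_res p H) i" for a
      by (metis fst_conv)
    then show ?thesis unfolding D_def mem_Collect_eq by metis
  qed
  have "equivalent (events_of seq_hist) (nths H (- D) @ Rs)"
    unfolding equivalent_def
  proof
    fix p :: nat
    let ?P = "\<lambda>e. proc e = p"
    let ?xs = "map (\<lambda>i. (p, opn (p, i), ret (p, i))) [0..<n_res p H]"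
    consider (idle) "control c p = Idle" | (finished) r where "control c p = Done r"
      | (dropped) "control c p \<noteq> Idle" "\<And>r. control c p \<noteq> Done r"
      by blast
    then show "filter ?P (events_of seq_hist) = filter ?P (nths H (- D) @ Rs)"
    proof cases
      case idle
      then have "filter ?P (nths H (- D)) = filter ?P H"
        by (intro filter_nths_superset) (simp_all add: D[of _ p])
      then show ?thesis
        using idle by (simp add: seq_hist_projection n_effective_def history Rs resp_def)
    next
      case finished
      then have "filter ?P (nths H (- D)) = filter ?P H"
        by (intro filter_nths_superset) (simp_all add: D[of _ p] effective_def)
      moreover have "ret (p, n_res p H) = r"
        using control[of p] finished by simp
      ultimately show ?thesis
        using finished
        by (simp add: seq_hist_projection n_effective_def history Rs resp_def events_of_append)
    next
      case dropped
      let ?ys = "events_of ?xs"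
      have H: "filter ?P H = ?ys @ [Inv p (opn (p, n_res p H))]"
        using dropped by (simp add: history)
      then have "filter ?P (nths H (- D)) = ?ys"
      proof (rule filter_nths_drop_last)
        fix i assume i: "i < length H" "?P (H ! i)"
        let ?t = "filter ?P (take i H)" and ?u = "filter ?P (drop (Suc i) H)"
        have "?t @ filter ?P (H ! i # drop (Suc i) H) = filter ?P H"
          unfolding filter_append[symmetric] id_take_nth_drop[OF i(1), symmetric] ..
        then have eq: "?t @ H ! i # ?u = ?ys @ [Inv p (opn (p, n_res p H))]"
          using H i(2) by simp
        have n_ys: "n_inv p ?ys = n_res p H"
          by (simp add: n_inv_events_of)
        have mem: "i \<in> D \<longleftrightarrow> (\<exists>x. H ! i = Inv p x) \<and> n_inv p ?t = n_res p H"
          using D[of i p] i dropped n_inv_projection[of p "take i H"]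
          by (auto simp: effective_def inv_at_def)
        show "i \<in> - D \<longleftrightarrow> length ?t < length ?ys"
        \<comment> \<open>Either event \<open>i\<close> is the last event of \<open>p\<close>, which
          is the dropped invocation, or it lies within \<open>?ys\<close>. There are only
          \<open>n_res p H\<close> invocations in \<open>?ys\<close>, numbered from 0, so none of
          them has that number.\<close>
        proof (cases ?u rule: rev_cases)
          case Nil
          then have "?t = ?ys" "H ! i = Inv p (opn (p, n_res p H))" using eq by auto
          then show ?thesis using mem n_ys by simp
        next
          case (snoc u e)
          then have ys: "?ys = ?t @ H ! i # u"
            using arg_cong[OF eq, of butlast] by (simp add: butlast_append)
          have "\<not> ((\<exists>x. H ! i = Inv p x) \<and> n_inv p ?t = n_res p H)"
            using n_ys unfolding ys by auto
          then show ?thesis using mem arg_cong[OF ys, of length] by simp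
        qed
      qed
      moreover have "resp p = []"
        using dropped by (auto simp: resp_def split: control.splits)
      ultimately show ?thesis
        using dropped by (simp add: seq_hist_projection n_effective_def Rs)
    qed
  qed
  note equiv = this
  have "completion H (nths H (- D) @ Rs)"
    unfolding completion_def
  proof (intro exI[of _ D] exI[of _ Rs] conjI)
    show "\<forall>i\<in>D. \<exists>a. inv_at H a i \<and> pending H a" unfolding D_def by blast
    show "\<forall>e\<in>set Rs. \<exists>p r. e = Res p r" using resp unfolding Rs_def by force
    show "well_formed (nths H (- D) @ Rs)" by (rule equivalent_events_of(1)[OF equiv])
    show "\<nexists>a. pending (nths H (- D) @ Rs) a" using equivalent_events_of(2)[OF equiv] by blast
  qed (rule refl)
  then show ?thesis using equiv by blast
qed

lemma seq_hist_order:
  assumes "a \<in> operations (events_of seq_hist)" "b \<in> operations (events_of seq_hist)"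
    and "op_less H a b"
  shows "op_less (events_of seq_hist) a b"
proof -
  have b: "b \<in> set lin" using assms(2) by (simp add: operations_seq)
  then have "key a < key b" using op_less_key[OF assms(3)] by (simp add: set_lin)
  obtain i j where ij: "i < length lin" "lin ! i = a" "j < length lin" "lin ! j = b"
    using assms(1) b by (auto simp: operations_seq in_set_conv_nth)
  have "i < j"
  proof (rule ccontr)
    assume "\<not> i < j"
    then have "key b \<le> key a"
      using sorted_wrt_nth_less[OF sorted_lin, of j i] ij by (cases "i = j") auto
    then show False using \<open>key a < key b\<close> by simp
  qed
  then show ?thesis using op_less_seq ij by blast
qed

text \<open>The state before an operation \<open>a\<close> consists of the marks of the effective
  add operations with a smaller key. Each mark belongs to one operation, which gives freshness; the
  order of marks is the order of keys, which gives the answers of queries.\<close>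

lemma seq_hist_legal: "seq_hist \<in> causal_monitor"
proof -
  have "cm_legal [] (map (\<lambda>a. (fst a, opn a, ret a)) lin)"
  proof (rule cm_legalI)
    fix j assume j: "j < length lin"
    define a where "a = lin ! j"
    define M where "M = take j lin"
    define S where "S = concat (map (marks_of \<circ> opn) M)"
    have a: "effective H (control c) a"
      using j nth_mem[of j lin] by (simp add: a_def set_lin)
    have split: "lin = M @ a # drop (Suc j) lin"
      unfolding a_def M_def using j by (rule id_take_nth_drop)
    have sorted: "sorted_wrt (\<lambda>a b. key a < key b) (M @ a # drop (Suc j) lin)"
      using sorted_lin by (simp only: split[symmetric])
    have M: "b \<in> set M \<longleftrightarrow> effective H (control c) b \<and> key b < key a" for b
    proof -
      have "effective H (control c) b \<longleftrightarrow> b \<in> set (M @ a # drop (Suc j) lin)"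
        by (simp only: split[symmetric] set_lin mem_Collect_eq)
      then show ?thesis using sorted by (auto simp: sorted_wrt_append)
    qed
    have S: "(k, y) \<in> set S \<longleftrightarrow> (\<exists>b\<in>set M. opn b = add_op k y)" for k y
      by (auto simp: S_def marks_of_eq)
    have fresh: "(k, y) \<notin> set S" if "opn a = add_op k y" for k y
    proof
      assume "(k, y) \<in> set S"
      then obtain b where "effective H (control c) b" "key b < key a" "opn b = add_op k y"
        by (auto simp: S M)
      then show False using unique[of a b k y] that a effective_operations by auto
    qed
    \<comment> \<open>Both operations belong to the same process, which issues
      \<open>Add_Inv\<close> first.\<close>
    have invoked: "\<exists>b'. effective H (control c) b' \<and> key b' < key b \<and> opn b' = Add_Inv y"
      if eff: "effective H (control c) b" and res: "opn b = Add_Res y" for b y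
    proof -
      obtain p n where b: "b = (p, n)" by (cases b)
      then obtain n' where "n' < n" "opn (p, n') = Add_Inv y"
        using invoked_before[of p n y] res effective_operations[OF eff] unfolding b by blast
      then show ?thesis using same_process_key[of p n n'] eff b by blast
    qed
    \<comment> \<open>The response record has a time of at most that of the query and wins a tie by
      \<open>kind\<close>; the invocation record comes before the response record.\<close>
    have recorded: "(k, y) \<in> set S" if y: "y \<in> query_ids (opn a)" for k y
    proof -
      obtain b where b: "effective H (control c) b" "opn b = Add_Res y" "tm b \<le> tm a"
        using query_written[OF effective_operations[OF a] y] by blast
      have "key b < key a"
        using b y kind_less[of "opn a" RMark y] by (auto simp: key_def)
      moreover obtain b' where "effective H (control c) b'" "key b' < key b" "opn b' = Add_Inv y"
        using invoked b by blast
      ultimately show ?thesis using b by (cases k) (auto simp: S M)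
    qed
    have precedes: "cm_precedes S y z \<longleftrightarrow> t < t'"
      if y: "y \<in> query_ids (opn a)" "stamped m H (control c) opn tm (RMark, y) t"
        and z: "z \<in> query_ids (opn a)" "stamped m H (control c) opn tm (IMark, z) t'"
      for y z t t'
    proof -
      \<comment> \<open>The timestamp may have been read long after the query was invoked. By
        \<open>recorded\<close> the mark is nevertheless in \<open>S\<close>, and by uniqueness its
        operation is the one that the query has seen.\<close>
      have ex: "\<exists>b\<in>set M. tm b = normal_stamp m u \<and> opn b = add_op k x \<and>
          (\<forall>d\<in>set M. (k, x) \<in> set ((marks_of \<circ> opn) d) \<longleftrightarrow> d = b)"
        if x: "x \<in> query_ids (opn a)" "stamped m H (control c) opn tm (k, x) u" for k x u
      proof -
        obtain b where b: "effective H (control c) b" "opn b = add_op k x" "tm b = normal_stamp m u"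
          using x(2) by (auto simp: stamped_def)
        have eq: "d = b" if "d \<in> set M" "opn d = add_op k x" for d
          using unique[of d b k x] that b M effective_operations by blast
        obtain d where "d \<in> set M" "opn d = add_op k x"
          using recorded[OF x(1), of k] by (auto simp: S)
        then have "b \<in> set M" using eq by blast
        moreover have "\<forall>d\<in>set M. (k, x) \<in> set ((marks_of \<circ> opn) d) \<longleftrightarrow> d = b"
          unfolding comp_apply marks_of_eq using b eq by blast
        ultimately show ?thesis using b by blast
      qed
      obtain b where b: "b \<in> set M" "tm b = normal_stamp m t" "opn b = add_op RMark y"
          "\<And>d. d \<in> set M \<Longrightarrow> (RMark, y) \<in> set ((marks_of \<circ> opn) d) \<longleftrightarrow> d = b"
        using ex[OF y] by blast
      obtain b' where b': "b' \<in> set M" "tm b' = normal_stamp m t'" "opn b' = add_op IMark z"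
          "\<And>d. d \<in> set M \<Longrightarrow> (IMark, z) \<in> set ((marks_of \<circ> opn) d) \<longleftrightarrow> d = b'"
        using ex[OF z] by blast
      have M_sorted: "sorted_wrt (\<lambda>a b. key a < key b) M"
        using sorted by (simp add: sorted_wrt_append)
      show ?thesis
      proof (cases "t < t'")
        case True
        then have "key b < key b'" by (simp add: key_def b b')
        from idx_less_sorted[OF M_sorted b(1) b'(1) this b(4) b'(4)] True show ?thesis
          by (simp add: cm_precedes_def S_def o_def)
      next
        case False
        \<comment> \<open>On equal timestamps the invocation mark comes first because of
          \<open>kind\<close>, in agreement with the strict comparison of the algorithm.\<close>
        then have "tm b' \<le> tm b"
          using normal_stamp_less_iff[of m t t'] by (simp add: b b' del: normal_stamp_less_iff)
        then have "key b' < key b" by (auto simp: key_def b(3) b'(3))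
        from idx_less_sorted[OF M_sorted b'(1) b(1) this b'(4) b(4)] False show ?thesis
          by (simp add: cm_precedes_def S_def o_def)
      qed
    qed
    obtain ts where ts: "list_all2 (stamped m H (control c) opn tm) (query_keys (opn a)) ts"
      and ret: "ret a = answer (opn a) ts"
      using returned[OF a] by blast
    have "cm_requires S (opn a) \<and> ret a = cm_return S (opn a)"
    proof (cases "opn a")
      case (Add_Inv y)
      then show ?thesis using fresh[of IMark y] ret by simp
    next
      case (Add_Res y)
      then obtain b where "effective H (control c) b" "key b < key a" "opn b = Add_Inv y"
        using invoked[OF a] by blast
      then have "(IMark, y) \<in> set S" by (auto simp: S M)
      then show ?thesis using Add_Res fresh[of RMark y] ret by simp
    next
      case (Precedes y z)
      then show ?thesis
        using recorded[of y RMark] recorded[of z RMark] ts ret precedes[of y _ z]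
        by (auto simp: precedes_keys_def list_all2_Cons1)
    next
      case (Concurrent y z)
      then show ?thesis
        using recorded[of y RMark] recorded[of z RMark] ts ret precedes[of y _ z] precedes[of z _ y]
        by (auto simp: precedes_keys_def list_all2_Cons1)
    qed
    then show "cm_requires ([] @ concat (map (marks_of \<circ> opn) (take j lin))) (opn (lin ! j)) \<and>
        ret (lin ! j) = cm_return ([] @ concat (map (marks_of \<circ> opn) (take j lin))) (opn (lin ! j))"
      by (simp add: S_def M_def a_def)
  qed
  then show ?thesis by (simp add: causal_monitor_def)
qed

end

theorem proposition14:
  fixes m :: stamp_mode and N :: nat
  shows "linearizable
           (monitor_histories m N :: (nat, 'id cm_op, cm_ret) history set) causal_monitor"
  unfolding linearizable_def
proof (intro ballI impI)
  fix H :: "(nat, 'id cm_op, cm_ret) history"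
  assume "H \<in> monitor_histories m N"
  then obtain c opn ret tm pos where "simulation m N H c opn ret tm pos"
    using execution_simulation by (auto simp: monitor_histories_def) blast
  then interpret simulation m N H c opn ret tm pos .
  show "\<exists>xs\<in>causal_monitor. (\<exists>H'. completion H H' \<and> equivalent (events_of xs) H') \<and>
      (\<forall>a\<in>operations (events_of xs). \<forall>b\<in>operations (events_of xs).
         op_less H a b \<longrightarrow> op_less (events_of xs) a b)"
    using seq_hist_legal seq_hist_completion seq_hist_order by blast
qed

end
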